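(* Let $\{\pi_k\}_{k\ge0}$ and $\{V^{\pi_k}\}_{k\ge0}$ be the policy and value sequences generated by PMD with mirror map $h(p)=\sum_a\psi(p(a))$ and a constant step size $\eta>0$. If $\psi'(0^+)=-\infty$ and $\psi'(1^-)<+\infty$, then for any $\sigma\in(0,\Delta/2)$ there exist finite iterations $T_1(\sigma)$ and $T_2(\sigma)$ and finite constants $C_1(\sigma)$ and $C_2(\sigma)$ such that $$\forall\,k\ge T_1(\sigma):\quad \|V^*-V^{\pi_k}\|_\infty\le\frac{|\mathcal A|}{(1-\gamma)^2}\,\varphi^{-1}\big(k\eta(\Delta-2\sigma)-C_1(\sigma)\big),$$ $$\forall\,k\ge T_2(\sigma):\quad \|V^*-V^{\pi_k}\|_\infty\ge\Delta\cdot\varphi^{-1}\big(k\eta(\Delta+2\sigma)-C_2(\sigma)\big).$$ Here $\varphi(x):=-\psi'(x)$ is a continuous and strictly decreasing function mapping $(0,1]$ onto $[-\psi'(1^-),+\infty)$, and $\varphi^{-1}$ denotes its inverse.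
   Context: MDP: $(\mathcal S,\mathcal A,P,r,\gamma)$ is a finite discounted Markov decision process: finite state space $\mathcal S$, finite action space $\mathcal A$, transition model $P(\cdot|s,a)\in\Delta(\mathcal S)$, reward $r:\mathcal S\times\mathcal A\to[0,1]$, discount $\gamma\in[0,1)$. $\Delta(\mathcal X)$ is the probability simplex over a finite set $\mathcal X$. A policy $\pi$ assigns to each $s$ a distribution $\pi(\cdot|s)\in\Delta(\mathcal A)$; $\Pi$ is the set of all policies. $V^\pi(s)$ is the expected value of $\sum_{t\ge0}\gamma^t r(s_t,a_t)$ given $s_0=s$, $a_t\sim\pi(\cdot|s_t)$, $s_{t+1}\sim P(\cdot|s_t,a_t)$, and $Q^\pi(s,a)$ is the same conditioned on $(s_0,a_0)=(s,a)$. $V^*(s)=\max_{\pi\in\Pi}V^\pi(s)$, $Q^*(s,a)=\max_{\pi\in\Pi}Q^\pi(s,a)$. $\mathcal A^*_s=\{a: Q^*(s,a)=V^*(s)\}$, $\tilde{\mathcal S}=\{s:\mathcal A_s^*\ne\mathcal A\}$, assumed nonempty throughout. For $s\in\tilde{\mathcal S}$, $\Delta_s=V^*(s)-\max_{a'\notin\mathcal A_s^*}Q^*(s,a')$, and $\Delta=\min_{s\in\tilde{\mathcal S}}\Delta_s>0$ (a number; not to be confused with the simplex $\Delta(\cdot)$). Mirror map: $\psi:\mathbb R\to(-\infty,+\infty]$ satisfies: (a) $\mathrm{dom}\,\psi\supseteq[0,1]$; (b) $\psi$ is proper, closed and convex; (c) $\psi$ is differentiable on $\mathrm{int}\,\mathrm{dom}\,\psi$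 and $|\psi'(x_n)|\to\infty$ for every sequence $\{x_n\}\subseteq\mathrm{int}\,\mathrm{dom}\,\psi$ converging to a boundary point of $\mathrm{dom}\,\psi$; (d) $\psi$ is strictly convex on $\mathrm{int}\,\mathrm{dom}\,\psi$. $\psi'(0^+)$ and $\psi'(1^-)$ are the one-sided limits of $\psi'$ at $0$ from the right and at $1$ from the left. $h(p)=\sum_{a\in\mathcal A}\psi(p(a))$ and $D_h(p\|q)=h(p)-h(q)-\langle\nabla h(q),p-q\rangle$. PMD: given $\eta>0$ and an initial policy $\pi_0$ with $\pi_0(a|s)\in\mathrm{int}\,\mathrm{dom}\,\psi$ for all $(s,a)$ (assumed throughout), for each $s$, $\pi_{k+1}(\cdot|s)=\arg\max_{p\in\Delta(\mathcal A)}\{\eta\langle p,Q^{\pi_k}(s,\cdot)\rangle-D_h(p\|\pi_k(\cdot|s))\}$; all iterates satisfy $\pi_k(a|s)\in\mathrm{int}\,\mathrm{dom}\,\psi$. *)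

theory Defs
  imports "HOL-Probability.Probability"
begin

section \<open>Finite discounted Markov decision processes\<close>

text \<open>
  States and actions range over (nonempty) finite types, and a distribution over a finite set is a
  \<^typ>\<open>'x pmf\<close>.  So a policy is a map \<^typ>\<open>'s \<Rightarrow> 'a pmf\<close>, and the set of all policies is
  \<^term>\<open>UNIV :: ('s \<Rightarrow> 'a pmf) set\<close>.

  A trajectory is a sequence of state-action pairs.  Its law, for a given law \<open>\<mu>\<close> of the first
  pair, is the measure on the infinite product space provided by the Ionescu-Tulcea theorem.
\<close>

type_synonym ('s, 'a) policy = "'s \<Rightarrow> 'a pmf"

definition traj_kernel ::
    "('s \<Rightarrow> 'a \<Rightarrow> 's pmf) \<Rightarrow> ('s, 'a) policy \<Rightarrow> ('s \<times> 'a) pmf \<Rightarrow>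
     nat \<Rightarrow> (nat \<Rightarrow> 's \<times> 'a) \<Rightarrow> ('s \<times> 'a) measure" where
  "traj_kernel P \<pi> \<mu> n \<omega> = measure_pmf
     (case n of
        0 \<Rightarrow> \<mu>
      | Suc m \<Rightarrow> bind_pmf (P (fst (\<omega> m)) (snd (\<omega> m))) (\<lambda>s'. map_pmf (Pair s') (\<pi> s')))"

definition trajectory ::
    "('s \<Rightarrow> 'a \<Rightarrow> 's pmf) \<Rightarrow> ('s, 'a) policy \<Rightarrow> ('s \<times> 'a) pmf \<Rightarrow> (nat \<Rightarrow> 's \<times> 'a) measure" where
  "trajectory P \<pi> \<mu> =
     projective_family.lim UNIV
       (Ionescu_Tulcea.CI (traj_kernel P \<pi> \<mu>) (\<lambda>_. count_space UNIV)) (\<lambda>_. count_space UNIV)"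

text \<open>The library constants used above are meaningful because their locale applies:\<close>

lemma Ionescu_Tulcea_traj_kernel:
  fixes P :: "'s::finite \<Rightarrow> 'a::finite \<Rightarrow> 's pmf"
  shows "Ionescu_Tulcea (traj_kernel P \<pi> \<mu>) (\<lambda>_. count_space UNIV)"
proof (rule Ionescu_Tulcea.intro)
  fix i
  show "traj_kernel P \<pi> \<mu> i \<in>
      measurable (PiM {0..<i} (\<lambda>_. count_space UNIV)) (subprob_algebra (count_space UNIV))"
  proof (cases i)
    case 0
    then show ?thesis
      by (simp add: traj_kernel_def[abs_def] measure_pmf_in_subprob_algebra)
  next
    case (Suc m)
    let ?K = "\<lambda>x. measure_pmf (bind_pmf (P (fst x) (snd x)) (\<lambda>s'. map_pmf (Pair s') (\<pi> s')))"
    have "?K \<in> measurable (count_space UNIV) (subprob_algebra (count_space UNIV))"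
      by (simp add: measure_pmf_in_subprob_algebra)
    moreover have "(\<lambda>\<omega>. \<omega> m) \<in> measurable (PiM {0..<i} (\<lambda>_. count_space UNIV)) (count_space UNIV)"
      using Suc by (intro measurable_component_singleton) auto
    ultimately have "(\<lambda>\<omega>. ?K (\<omega> m)) \<in>
        measurable (PiM {0..<i} (\<lambda>_. count_space UNIV)) (subprob_algebra (count_space UNIV))"
      by (rule measurable_compose[rotated])
    then show ?thesis
      using Suc by (simp add: traj_kernel_def[abs_def])
  qed
qed (simp add: traj_kernel_def prob_space_measure_pmf)

definition discounted_return ::
    "('s \<Rightarrow> 'a \<Rightarrow> real) \<Rightarrow> real \<Rightarrow> (nat \<Rightarrow> 's \<times> 'a) \<Rightarrow> real" where
  "discounted_return r \<gamma> \<omega> = (\<Sum>t. \<gamma> ^ t * r (fst (\<omega> t)) (snd (\<omega> t)))"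

definition V_fun where
  "V_fun P r \<gamma> \<pi> s =
     integral\<^sup>L (trajectory P \<pi> (map_pmf (Pair s) (\<pi> s))) (discounted_return r \<gamma>)"

definition Q_fun where
  "Q_fun P r \<gamma> \<pi> s a =
     integral\<^sup>L (trajectory P \<pi> (return_pmf (s, a))) (discounted_return r \<gamma>)"

text \<open>
  The maximum over the infinite set of all policies is written as a supremum, since
  \<^const>\<open>Max\<close> is meaningful for finite sets only; the set of values is bounded and nonempty.
\<close>

definition V_opt where
  "V_opt P r \<gamma> s = (SUP \<pi>. V_fun P r \<gamma> \<pi> s)"

definition Q_opt where
  "Q_opt P r \<gamma> s a = (SUP \<pi>. Q_fun P r \<gamma> \<pi> s a)"

definition opt_actions ::
    "('s::finite \<Rightarrow> 'a::finite \<Rightarrow> 's pmf) \<Rightarrow> ('s \<Rightarrow> 'a \<Rightarrow> real) \<Rightarrow> real \<Rightarrow> 's \<Rightarrow> 'a set" where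
  "opt_actions P r \<gamma> s = {a. Q_opt P r \<gamma> s a = V_opt P r \<gamma> s}"

definition nontrivial_states ::
    "('s::finite \<Rightarrow> 'a::finite \<Rightarrow> 's pmf) \<Rightarrow> ('s \<Rightarrow> 'a \<Rightarrow> real) \<Rightarrow> real \<Rightarrow> 's set" where
  "nontrivial_states P r \<gamma> = {s. opt_actions P r \<gamma> s \<noteq> UNIV}"

definition state_gap ::
    "('s::finite \<Rightarrow> 'a::finite \<Rightarrow> 's pmf) \<Rightarrow> ('s \<Rightarrow> 'a \<Rightarrow> real) \<Rightarrow> real \<Rightarrow> 's \<Rightarrow> real" where
  "state_gap P r \<gamma> s = V_opt P r \<gamma> s - (MAX a \<in> - opt_actions P r \<gamma> s. Q_opt P r \<gamma> s a)"

definition gap ::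
    "('s::finite \<Rightarrow> 'a::finite \<Rightarrow> 's pmf) \<Rightarrow> ('s \<Rightarrow> 'a \<Rightarrow> real) \<Rightarrow> real \<Rightarrow> real" where
  "gap P r \<gamma> = (MIN s \<in> nontrivial_states P r \<gamma>. state_gap P r \<gamma> s)"

definition sup_norm :: "('s::finite \<Rightarrow> real) \<Rightarrow> real" where
  "sup_norm f = (MAX s. \<bar>f s\<bar>)"


section \<open>Mirror maps\<close>

definition eff_dom :: "(real \<Rightarrow> ereal) \<Rightarrow> real set" where
  "eff_dom \<psi> = {x. \<psi> x < \<infinity>}"

text \<open>
  Derivative of an extended-real-valued function.  Only its values on the interior of the effective
  domain are meaningful: near such points \<open>\<psi>\<close> is finite and agrees with its real part.
\<close>

definition ederiv :: "(real \<Rightarrow> ereal) \<Rightarrow> real \<Rightarrow> real" where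
  "ederiv \<psi> = deriv (\<lambda>x. real_of_ereal (\<psi> x))"

definition ereal_epigraph :: "(real \<Rightarrow> ereal) \<Rightarrow> (real \<times> real) set" where
  "ereal_epigraph \<psi> = {(x, t). \<psi> x \<le> ereal t}"

definition strictly_convex_on :: "real set \<Rightarrow> (real \<Rightarrow> real) \<Rightarrow> bool" where
  "strictly_convex_on S f \<longleftrightarrow> convex S \<and>
     (\<forall>x\<in>S. \<forall>y\<in>S. \<forall>t. x \<noteq> y \<longrightarrow> 0 < t \<longrightarrow> t < 1 \<longrightarrow>
        f ((1 - t) * x + t * y) < (1 - t) * f x + t * f y)"

text \<open>
  As usual in convex analysis, proper means nowhere \<open>-\<infinity>\<close> and somewhere finite, and closed and
  convex refer to the epigraph.
\<close>

definition mirror_map :: "(real \<Rightarrow> ereal) \<Rightarrow> bool" where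
  "mirror_map \<psi> \<longleftrightarrow>
     {0..1} \<subseteq> eff_dom \<psi> \<and>
     (\<forall>x. \<psi> x \<noteq> -\<infinity>) \<and> eff_dom \<psi> \<noteq> {} \<and>
     closed (ereal_epigraph \<psi>) \<and> convex (ereal_epigraph \<psi>) \<and>
     (\<lambda>x. real_of_ereal (\<psi> x)) differentiable_on interior (eff_dom \<psi>) \<and>
     (\<forall>X b. (\<forall>n::nat. X n \<in> interior (eff_dom \<psi>)) \<longrightarrow> b \<in> frontier (eff_dom \<psi>) \<longrightarrow>
        X \<longlonglongrightarrow> b \<longrightarrow> filterlim (\<lambda>n. \<bar>ederiv \<psi> (X n)\<bar>) at_top sequentially) \<and>
     strictly_convex_on (interior (eff_dom \<psi>)) (\<lambda>x. real_of_ereal (\<psi> x))"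

definition phi :: "(real \<Rightarrow> ereal) \<Rightarrow> real \<Rightarrow> real" where
  "phi \<psi> x = - ederiv \<psi> x"

text \<open>Inverse of the restriction to \<open>(0,1]\<close>; meaningful only at points of \<open>phi \<psi> ` {0<..1}\<close>.\<close>

definition phi_inv :: "(real \<Rightarrow> ereal) \<Rightarrow> real \<Rightarrow> real" where
  "phi_inv \<psi> = the_inv_into {0<..1} (phi \<psi>)"


section \<open>Policy mirror descent\<close>

definition vec_of_pmf :: "'a::finite pmf \<Rightarrow> real ^ 'a" where
  "vec_of_pmf p = (\<chi> a. pmf p a)"

text \<open>
  A real-valued function suffices here: probability vectors lie in \<open>[0,1]\<close> componentwise, where
  \<open>\<psi>\<close> is finite.
\<close>

definition sep_map :: "(real \<Rightarrow> ereal) \<Rightarrow> real ^ 'a::finite \<Rightarrow> real" where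
  "sep_map \<psi> p = (\<Sum>a\<in>UNIV. real_of_ereal (\<psi> (p $ a)))"

text \<open>The term \<open>\<langle>\<nabla>h(q), p - q\<rangle>\<close> is the total derivative of \<open>h\<close> at \<open>q\<close>, applied to \<open>p - q\<close>.\<close>

definition bregman :: "(real ^ 'a::finite \<Rightarrow> real) \<Rightarrow> real ^ 'a \<Rightarrow> real ^ 'a \<Rightarrow> real" where
  "bregman h p q = h p - h q - frechet_derivative h (at q) (p - q)"

text \<open>Since \<^typ>\<open>'a pmf\<close> is the whole simplex, the side condition of \<^const>\<open>is_arg_max\<close> is trivial.\<close>

definition pmd_sequence ::
    "('s::finite \<Rightarrow> 'a::finite \<Rightarrow> 's pmf) \<Rightarrow> ('s \<Rightarrow> 'a \<Rightarrow> real) \<Rightarrow> real \<Rightarrow>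
     (real \<Rightarrow> ereal) \<Rightarrow> real \<Rightarrow> (nat \<Rightarrow> ('s, 'a) policy) \<Rightarrow> bool" where
  "pmd_sequence P r \<gamma> \<psi> \<eta> \<pi> \<longleftrightarrow>
     (\<forall>s a. pmf (\<pi> 0 s) a \<in> interior (eff_dom \<psi>)) \<and>
     (\<forall>k s. is_arg_max
        (\<lambda>p. \<eta> * (vec_of_pmf p \<bullet> (\<chi> a. Q_fun P r \<gamma> (\<pi> k) s a))
             - bregman (sep_map \<psi>) (vec_of_pmf p) (vec_of_pmf (\<pi> k s)))
        (\<lambda>_. True) (\<pi> (Suc k) s))"

end

theory Submission
  imports Defs
begin

text \<open>
  Write \<open>\<phi> = - \<psi>'\<close>.  Because \<open>\<psi>'\<close> is \<open>-\<infinity>\<close> at \<open>0\<close>, a maximiser of the mirror descent objective has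
  full support, so the first-order conditions on the simplex hold with equality: within a state,
  \<open>\<phi>(\<pi>\<^sub>k\<^sub>+\<^sub>1(a)) - \<phi>(\<pi>\<^sub>k(a)) + \<eta> Q\<^sup>k(a)\<close> does not depend on \<open>a\<close> (\<open>mirror_step_stationary\<close>).  Hence the
  dual gap \<open>\<phi>(\<pi>\<^sub>k(a)) - \<phi>(\<pi>\<^sub>k(b))\<close> of two actions grows by exactly \<open>\<eta> (Q\<^sup>k(b) - Q\<^sup>k(a))\<close> per iteration
  (\<open>dual_gap_Suc\<close>), and everything is read off from this recursion.

  Convergence comes without a rate.  Each step is a policy improvement, since \<open>\<phi>\<close> is decreasing
  (\<open>mirror_step_improves\<close>), so the values increase to a limit \<open>W\<close> (\<open>V_lim\<close> below), and the action values converge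
  too.  If \<open>a\<close> is beaten by \<open>b\<close> in the limit, their dual gap tends to infinity; as \<open>\<phi> \<ge> \<phi>(1)\<close> is
  bounded below on \<open>(0,1]\<close>, this forces \<open>\<phi>(\<pi>\<^sub>k(a)) \<rightarrow> \<infinity>\<close>, that is, \<open>\<pi>\<^sub>k(a) \<rightarrow> 0\<close> (\<open>mass_vanishes\<close>).
  All mass ends on the limit-greedy actions, so \<open>W\<close> solves the Bellman optimality equation
  (\<open>V_lim_fixpoint\<close>).  Every policy value lies below such a solution and the iterates approach it,
  so \<open>W = V\<^sup>*\<close> (\<open>optimal_values_of_limit\<close>).

  For the upper bound (\<open>upper_rate\<close>), once \<open>Q\<^sup>k\<close> is \<open>\<sigma>\<close>-close to \<open>Q\<^sup>*\<close>, the dual gap of a suboptimal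
  action to an optimal one grows by at least \<open>\<eta> (\<Delta> - 2 \<sigma>)\<close> per step, which bounds the mass of every
  suboptimal action by \<open>\<phi>\<^sup>-\<^sup>1(k \<eta> (\<Delta> - 2 \<sigma>) - C\<^sub>1)\<close>; the loss of a policy is at most
  \<open>|A| / (1 - \<gamma>)\<^sup>2\<close> times the largest such mass (\<open>suboptimality_le\<close>).  For the lower bound (\<open>lower_rate\<close>), take a state and action attaining
  \<open>\<Delta>\<close>.  Against every other action the dual gap grows by at most \<open>\<eta> (\<Delta> + 2 \<sigma>)\<close>, and some action has mass
  at least \<open>1 / |A|\<close> in each iteration, so its dual variable is at most \<open>\<phi>(1 / |A|)\<close>.  Thus the mass
  of the chosen action is at least \<open>\<phi>\<^sup>-\<^sup>1(k \<eta> (\<Delta> + 2 \<sigma>) - C\<^sub>2)\<close>, and each unit of it costs \<open>\<Delta>\<close>.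
\<close>

section \<open>Laws of the state-action pairs along a trajectory\<close>

definition pair_kernel ::
    "('s \<Rightarrow> 'a \<Rightarrow> 's pmf) \<Rightarrow> ('s, 'a) policy \<Rightarrow> 's \<times> 'a \<Rightarrow> ('s \<times> 'a) pmf" where
  "pair_kernel P \<pi> x = bind_pmf (P (fst x) (snd x)) (\<lambda>s'. map_pmf (Pair s') (\<pi> s'))"

primrec step_law ::
    "('s \<Rightarrow> 'a \<Rightarrow> 's pmf) \<Rightarrow> ('s, 'a) policy \<Rightarrow> nat \<Rightarrow> ('s \<times> 'a) pmf \<Rightarrow> ('s \<times> 'a) pmf" where
  "step_law P \<pi> 0 \<mu> = \<mu>"
| "step_law P \<pi> (Suc n) \<mu> = bind_pmf (step_law P \<pi> n \<mu>) (pair_kernel P \<pi>)"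

lemma traj_kernel_simps:
  "traj_kernel P \<pi> \<mu> 0 \<omega> = measure_pmf \<mu>"
  "traj_kernel P \<pi> \<mu> (Suc n) \<omega> = measure_pmf (pair_kernel P \<pi> (\<omega> n))"
  by (simp_all add: traj_kernel_def pair_kernel_def)

text \<open>
  Together with the next lemma this is the Markov property at the level of one-time laws, which is
  all that a discounted sum of expected rewards depends on.
\<close>

lemma step_law_Suc_first:
  "step_law P \<pi> (Suc n) \<mu> = step_law P \<pi> n (bind_pmf \<mu> (pair_kernel P \<pi>))"
  by (induction n) simp_all

lemma step_law_bind:
  "step_law P \<pi> n (bind_pmf \<mu> g) = bind_pmf \<mu> (\<lambda>x. step_law P \<pi> n (g x))"
  by (induction n) (simp_all add: bind_assoc_pmf)

text \<open>
  The marginals of the Ionescu-Tulcea measure can be computed from its finite-dimensional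
  approximations.  Since the kernel looks only at the last pair, integrating out that pair turns a
  function of the pair at time \<open>n + 1\<close> into a function of the pair at time \<open>n\<close>, and induction on
  the time applies with the integrand left arbitrary.
\<close>

lemma trajectory_marginal:
  fixes P :: "'s::finite \<Rightarrow> 'a::finite \<Rightarrow> 's pmf"
  shows "distr (trajectory P \<pi> \<mu>) (count_space UNIV) (\<lambda>\<omega>. \<omega> n) = measure_pmf (step_law P \<pi> n \<mu>)"
proof -
  interpret Ionescu_Tulcea "traj_kernel P \<pi> \<mu>" "\<lambda>_. count_space UNIV"
    by (rule Ionescu_Tulcea_traj_kernel)
  let ?M = "\<lambda>J. PiM J (\<lambda>_. count_space UNIV) :: (nat \<Rightarrow> 's \<times> 'a) measure"
  let ?C = "\<lambda>n. C 0 n (\<lambda>_. undefined)"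
  have coord [measurable]: "(\<lambda>\<omega>. \<omega> i) \<in> measurable (?M J) (count_space UNIV)" if "i \<in> J" for i J
    using that by (rule measurable_component_singleton)
  have undef: "(\<lambda>_. undefined) \<in> space (?M {0..<0})" by (simp add: space_PiM)
  have setsC: "sets (?C n) = sets (?M {0..<n})" for n
    using sets_C[OF undef, of n] by simp
  have last: "(\<integral>\<^sup>+\<omega>. f (\<omega> n) \<partial>?C (Suc n)) = (\<integral>\<^sup>+\<omega>. (\<integral>\<^sup>+x. f x \<partial>traj_kernel P \<pi> \<mu> n \<omega>) \<partial>?C n)"
    for f :: "'s \<times> 'a \<Rightarrow> ennreal" and n
  proof -
    have f: "(\<lambda>\<omega>. f (\<omega> n)) \<in> borel_measurable (?M {0..<Suc n})"
      by (rule measurable_compose[OF coord]) auto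
    have "(\<integral>\<^sup>+\<omega>. f (\<omega> n) \<partial>?C (Suc n)) = (\<integral>\<^sup>+\<omega>. (\<integral>\<^sup>+\<omega>'. f (\<omega>' n) \<partial>eP n \<omega>) \<partial>?C n)"
      using f measurable_eP[of n] undef
      by (simp add: nn_integral_bind[where B="?M {0..<Suc n}"] measurable_cong_sets[OF setsC refl])
    also have "\<dots> = (\<integral>\<^sup>+\<omega>. (\<integral>\<^sup>+x. f x \<partial>traj_kernel P \<pi> \<mu> n \<omega>) \<partial>?C n)"
      using space_C[OF undef, of n] f by (intro nn_integral_cong) (simp add: nn_integral_eP)
    finally show ?thesis .
  qed
  have C: "(\<integral>\<^sup>+\<omega>. f (\<omega> n) \<partial>?C (Suc n)) = (\<integral>\<^sup>+x. f x \<partial>step_law P \<pi> n \<mu>)"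
    for f :: "'s \<times> 'a \<Rightarrow> ennreal"
  proof (induction n arbitrary: f)
    case 0
    have "emeasure (?C 0) (space (?C 0)) = 1"
      using prob_space.emeasure_space_1[OF prob_space_C[OF undef, of 0]] by simp
    with last[where f=f and n=0] show ?case
      by (simp add: traj_kernel_simps del: C.simps)
  next
    case (Suc n)
    have "(\<integral>\<^sup>+\<omega>. f (\<omega> (Suc n)) \<partial>?C (Suc (Suc n)))
        = (\<integral>\<^sup>+\<omega>. (\<integral>\<^sup>+x. f x \<partial>pair_kernel P \<pi> (\<omega> n)) \<partial>?C (Suc n))"
      by (simp only: last traj_kernel_simps)
    also have "\<dots> = (\<integral>\<^sup>+y. (\<integral>\<^sup>+x. f x \<partial>pair_kernel P \<pi> y) \<partial>step_law P \<pi> n \<mu>)"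
      by (rule Suc.IH)
    finally show ?case by (simp add: nn_integral_bind_pmf)
  qed
  show ?thesis
  proof (rule measure_eqI)
    fix A :: "('s \<times> 'a) set"
    let ?J = "{0..<Suc n}"
    have "up_to ?J \<le> Suc n" "Suc n \<le> up_to ?J"
      using up_to_less[of ?J n] by (simp_all add: up_to_iff)
    then have up: "up_to ?J = Suc n" by simp
    have "emeasure (distr (trajectory P \<pi> \<mu>) (count_space UNIV) (\<lambda>\<omega>. \<omega> n)) A
        = emeasure (distr (distr PF.lim (?M ?J) (\<lambda>\<omega>. restrict \<omega> ?J)) (count_space UNIV) (\<lambda>\<omega>. \<omega> n)) A"
      unfolding trajectory_def
      by (subst distr_distr) (auto intro!: coord measurable_restrict simp: comp_def measurable_cong_sets[OF PF.sets_lim refl])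
    also have "distr PF.lim (?M ?J) (\<lambda>\<omega>. restrict \<omega> ?J) = CI ?J"
      by (rule distr_lim) simp
    also have "distr (CI ?J) (count_space UNIV) (\<lambda>\<omega>. \<omega> n) = distr (?C (Suc n)) (count_space UNIV) (\<lambda>\<omega>. \<omega> n)"
      unfolding CI_def up
      by (subst distr_distr)
         (auto intro!: coord measurable_restrict simp: comp_def measurable_cong_sets[OF setsC refl] simp del: C.simps)
    also have "emeasure \<dots> A = (\<integral>\<^sup>+\<omega>. indicator A (\<omega> n) \<partial>?C (Suc n))"
      by (subst nn_integral_indicator[symmetric], simp, subst nn_integral_distr)
         (auto intro!: coord simp: measurable_cong_sets[OF setsC refl] simp del: C.simps)
    also have "\<dots> = emeasure (step_law P \<pi> n \<mu>) A"
      by (simp only: C) simp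
    finally show "emeasure (distr (trajectory P \<pi> \<mu>) (count_space UNIV) (\<lambda>\<omega>. \<omega> n)) A
        = emeasure (step_law P \<pi> n \<mu>) A" .
  qed simp
qed

section \<open>Bellman equations and comparison principles\<close>

definition expected_return ::
    "('s \<Rightarrow> 'a \<Rightarrow> 's pmf) \<Rightarrow> ('s \<Rightarrow> 'a \<Rightarrow> real) \<Rightarrow> real \<Rightarrow> ('s, 'a) policy \<Rightarrow> ('s \<times> 'a) pmf \<Rightarrow> real" where
  "expected_return P r \<gamma> \<pi> \<mu> = integral\<^sup>L (trajectory P \<pi> \<mu>) (discounted_return r \<gamma>)"

lemma average_mono: "(\<Sum>x\<in>UNIV. pmf p x * f x) \<le> (\<Sum>x\<in>UNIV. pmf p x * g x)"
  if "\<And>x. f x \<le> g x" for p :: "'x::finite pmf" and f g :: "'x \<Rightarrow> real"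
  using that by (intro sum_mono mult_left_mono) auto

lemma average_le: "(\<Sum>x\<in>UNIV. pmf p x * f x) \<le> c"
  if "\<And>x. f x \<le> c" for p :: "'x::finite pmf" and f :: "'x \<Rightarrow> real"
  using average_mono[of f "\<lambda>_. c" p] that by (simp add: sum_distrib_right[symmetric] sum_pmf_eq_1)

lemma expectation_bind_pmf_finite:
  fixes \<mu> :: "'x::finite pmf" and g :: "'x \<Rightarrow> 'y::finite pmf" and f :: "'y \<Rightarrow> real"
  shows "measure_pmf.expectation (bind_pmf \<mu> g) f
    = (\<Sum>x\<in>UNIV. pmf \<mu> x * measure_pmf.expectation (g x) f)"
proof -
  have E: "measure_pmf.expectation p h = (\<Sum>x\<in>UNIV. pmf p x * h x)" for p :: "'z::finite pmf" and h
    by (subst integral_measure_pmf[of UNIV]) auto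
  have "measure_pmf.expectation (bind_pmf \<mu> g) f
      = (\<Sum>y\<in>UNIV. \<Sum>x\<in>UNIV. pmf \<mu> x * (pmf (g x) y * f y))"
    by (simp add: E pmf_bind sum_distrib_right mult.assoc)
  also have "\<dots> = (\<Sum>x\<in>UNIV. \<Sum>y\<in>UNIV. pmf \<mu> x * (pmf (g x) y * f y))"
    by (rule sum.swap)
  finally show ?thesis by (simp add: E sum_distrib_left)
qed

locale discounted_mdp =
  fixes P :: "'s::finite \<Rightarrow> 'a::finite \<Rightarrow> 's pmf"
    and r :: "'s \<Rightarrow> 'a \<Rightarrow> real"
    and \<gamma> :: real
  assumes reward: "\<And>s a. r s a \<in> {0..1}"
    and discount: "\<gamma> \<in> {0..<1}"
begin

lemma reward_bounds: "0 \<le> r s a" "r s a \<le> 1" and discount_bounds: "0 \<le> \<gamma>" "\<gamma> < 1"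
  using reward[of s a] discount by auto

definition step_reward where
  "step_reward \<pi> n \<mu> = measure_pmf.expectation (step_law P \<pi> n \<mu>) (\<lambda>x. r (fst x) (snd x))"

lemma step_reward_bounds: "0 \<le> step_reward \<pi> n \<mu>" "step_reward \<pi> n \<mu> \<le> 1"
proof -
  show "0 \<le> step_reward \<pi> n \<mu>"
    unfolding step_reward_def by (intro integral_nonneg_AE) (simp add: reward_bounds)
  show "step_reward \<pi> n \<mu> \<le> 1"
    unfolding step_reward_def
    by (intro measure_pmf.integral_le_const integrable_measure_pmf_finite) (auto simp: reward_bounds)
qed

lemma summable_step_reward: "summable (\<lambda>n. \<gamma> ^ n * step_reward \<pi> n \<mu>)"
proof (rule summable_comparison_test[OF _ summable_geometric[of \<gamma>]])
  show "\<exists>N. \<forall>n\<ge>N. norm (\<gamma> ^ n * step_reward \<pi> n \<mu>) \<le> \<gamma> ^ n"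
    using step_reward_bounds[of \<pi> _ \<mu>] discount_bounds by (auto simp: abs_mult intro!: mult_left_le)
qed (use discount_bounds in simp)

text \<open>
  The rewards are bounded and the discount is geometric, so sum and expectation may be exchanged.
\<close>

lemma expected_return_sums: "(\<lambda>n. \<gamma> ^ n * step_reward \<pi> n \<mu>) sums expected_return P r \<gamma> \<pi> \<mu>"
proof -
  let ?T = "trajectory P \<pi> \<mu>"
  interpret IT: Ionescu_Tulcea "traj_kernel P \<pi> \<mu>" "\<lambda>_. count_space UNIV"
    by (rule Ionescu_Tulcea_traj_kernel)
  have setsT: "sets ?T = sets (PiM UNIV (\<lambda>_. count_space UNIV))"
    by (simp add: trajectory_def)
  have coord: "(\<lambda>\<omega>. \<omega> n) \<in> measurable ?T (count_space UNIV)" for n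
    by (simp add: measurable_cong_sets[OF setsT refl])
  have marg: "integral\<^sup>L ?T (\<lambda>\<omega>. f (\<omega> n)) = measure_pmf.expectation (step_law P \<pi> n \<mu>) f"
      "integrable ?T (\<lambda>\<omega>. f (\<omega> n))" for n and f :: "'s \<times> 'a \<Rightarrow> real"
  proof -
    have f: "f \<in> borel_measurable (count_space UNIV)" by simp
    show "integral\<^sup>L ?T (\<lambda>\<omega>. f (\<omega> n)) = measure_pmf.expectation (step_law P \<pi> n \<mu>) f"
      using integral_distr[OF coord[of n] f] by (simp add: trajectory_marginal)
    have "integrable (measure_pmf (step_law P \<pi> n \<mu>)) f"
      by (rule integrable_measure_pmf_finite) simp
    then show "integrable ?T (\<lambda>\<omega>. f (\<omega> n))"
      using integrable_distr[OF coord[of n], of f] by (simp add: trajectory_marginal)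
  qed
  let ?f = "\<lambda>n \<omega>. \<gamma> ^ n * r (fst (\<omega> n)) (snd (\<omega> n))"
  have int: "integrable ?T (?f n)" for n
    using marg(2)[of "\<lambda>x. \<gamma> ^ n * r (fst x) (snd x)"] .
  have nrm: "norm (?f n \<omega>) = ?f n \<omega>" for n \<omega>
    using reward_bounds discount_bounds by (simp add: abs_mult)
  have eq: "integral\<^sup>L ?T (?f n) = \<gamma> ^ n * step_reward \<pi> n \<mu>" for n
    using marg(1)[of "\<lambda>x. \<gamma> ^ n * r (fst x) (snd x)" n] by (simp add: step_reward_def)
  have "(\<lambda>n. integral\<^sup>L ?T (?f n)) sums (\<integral>\<omega>. (\<Sum>n. ?f n \<omega>) \<partial>?T)"
  proof (rule sums_integral[OF int])
    have "summable (\<lambda>n. ?f n \<omega>)" for \<omega>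
      by (rule summable_comparison_test[OF _ summable_geometric[of \<gamma>]])
         (use reward_bounds discount_bounds in \<open>auto simp: abs_mult intro!: mult_left_le\<close>)
    then show "AE \<omega> in ?T. summable (\<lambda>n. norm (?f n \<omega>))" by (simp only: nrm) simp
    show "summable (\<lambda>n. \<integral>\<omega>. norm (?f n \<omega>) \<partial>?T)"
      by (simp only: nrm eq summable_step_reward)
  qed
  moreover have "discounted_return r \<gamma> = (\<lambda>\<omega>. \<Sum>n. ?f n \<omega>)"
    by (simp add: fun_eq_iff discounted_return_def)
  ultimately show ?thesis by (simp only: eq expected_return_def)
qed

lemma expected_return_bounds: "0 \<le> expected_return P r \<gamma> \<pi> \<mu>" "expected_return P r \<gamma> \<pi> \<mu> \<le> 1 / (1 - \<gamma>)"
proof -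
  show "0 \<le> expected_return P r \<gamma> \<pi> \<mu>"
    using expected_return_sums by (rule sums_le[OF _ sums_zero, rotated])
      (use step_reward_bounds discount_bounds in auto)
  have geom: "(\<lambda>n. \<gamma> ^ n) sums (1 / (1 - \<gamma>))"
    using discount_bounds by (intro geometric_sums) simp
  have le: "\<gamma> ^ n * step_reward \<pi> n \<mu> \<le> \<gamma> ^ n" for n
    using step_reward_bounds discount_bounds by (auto intro!: mult_left_le)
  show "expected_return P r \<gamma> \<pi> \<mu> \<le> 1 / (1 - \<gamma>)"
    by (rule sums_le[OF le expected_return_sums geom])
qed

lemma expected_return_bind:
  fixes \<mu> :: "'x::finite pmf"
  shows "expected_return P r \<gamma> \<pi> (bind_pmf \<mu> g) = (\<Sum>x\<in>UNIV. pmf \<mu> x * expected_return P r \<gamma> \<pi> (g x))"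
proof (rule sums_unique2[OF expected_return_sums])
  have "(\<lambda>n. \<Sum>x\<in>UNIV. pmf \<mu> x * (\<gamma> ^ n * step_reward \<pi> n (g x)))
      sums (\<Sum>x\<in>UNIV. pmf \<mu> x * expected_return P r \<gamma> \<pi> (g x))"
    by (intro sums_sum sums_mult expected_return_sums)
  then show "(\<lambda>n. \<gamma> ^ n * step_reward \<pi> n (bind_pmf \<mu> g))
      sums (\<Sum>x\<in>UNIV. pmf \<mu> x * expected_return P r \<gamma> \<pi> (g x))"
    by (simp add: step_reward_def step_law_bind expectation_bind_pmf_finite sum_distrib_left
      mult.left_commute)
qed

text \<open>
  The first pair contributes its reward; the remaining pairs form a process of the same kind,
  delayed by one step.
\<close>

lemma expected_return_first_step:
  "expected_return P r \<gamma> \<pi> (return_pmf x) = r (fst x) (snd x) + \<gamma> * expected_return P r \<gamma> \<pi> (pair_kernel P \<pi> x)"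
proof (rule sums_unique2[OF expected_return_sums])
  have "(\<lambda>n. \<gamma> * (\<gamma> ^ n * step_reward \<pi> n (pair_kernel P \<pi> x)))
      sums (\<gamma> * expected_return P r \<gamma> \<pi> (pair_kernel P \<pi> x))"
    by (intro sums_mult expected_return_sums)
  moreover have "step_reward \<pi> (Suc n) (return_pmf x) = step_reward \<pi> n (pair_kernel P \<pi> x)" for n
    by (simp only: step_reward_def step_law_Suc_first bind_return_pmf)
  ultimately have "(\<lambda>n. \<gamma> ^ Suc n * step_reward \<pi> (Suc n) (return_pmf x))
      sums (\<gamma> * expected_return P r \<gamma> \<pi> (pair_kernel P \<pi> x))"
    by (simp only: power_Suc mult.assoc)
  from sums_Suc[OF this] show "(\<lambda>n. \<gamma> ^ n * step_reward \<pi> n (return_pmf x))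
      sums (r (fst x) (snd x) + \<gamma> * expected_return P r \<gamma> \<pi> (pair_kernel P \<pi> x))"
    by (simp add: step_reward_def add.commute)
qed

abbreviation "V \<equiv> V_fun P r \<gamma>"
abbreviation "Q \<equiv> Q_fun P r \<gamma>"

lemma V_eq_expected_return: "V \<pi> s = expected_return P r \<gamma> \<pi> (map_pmf (Pair s) (\<pi> s))"
  and Q_eq_expected_return: "Q \<pi> s a = expected_return P r \<gamma> \<pi> (return_pmf (s, a))"
  by (simp_all add: V_fun_def Q_fun_def expected_return_def)

lemma V_eq_average_Q: "V \<pi> s = (\<Sum>a\<in>UNIV. pmf (\<pi> s) a * Q \<pi> s a)"
  by (simp add: V_eq_expected_return Q_eq_expected_return map_pmf_def expected_return_bind)

definition backup :: "('s \<Rightarrow> real) \<Rightarrow> 's \<Rightarrow> 'a \<Rightarrow> real" where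
  "backup v s a = r s a + \<gamma> * (\<Sum>s'\<in>UNIV. pmf (P s a) s' * v s')"

lemma Q_eq_backup_V: "Q \<pi> s a = backup (V \<pi>) s a"
  by (simp add: Q_eq_expected_return V_eq_expected_return backup_def expected_return_first_step pair_kernel_def expected_return_bind)

lemma V_bounds: "0 \<le> V \<pi> s" "V \<pi> s \<le> 1 / (1 - \<gamma>)"
  by (simp_all add: V_eq_expected_return expected_return_bounds)

lemma backup_mono: "v \<le> w \<Longrightarrow> backup v s a \<le> backup w s a"
  unfolding backup_def using discount_bounds
  by (intro add_left_mono mult_left_mono average_mono) (auto simp: le_fun_def)

lemma backup_le_add:
  assumes "\<And>s. v s - w s \<le> c"
  shows "backup v s a \<le> backup w s a + \<gamma> * c"
proof -
  have "(\<Sum>s'\<in>UNIV. pmf (P s a) s' * v s') - (\<Sum>s'\<in>UNIV. pmf (P s a) s' * w s')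
      = (\<Sum>s'\<in>UNIV. pmf (P s a) s' * (v s' - w s'))"
    by (simp add: sum_subtractf right_diff_distrib)
  also have "\<dots> \<le> c" by (rule average_le) (rule assms)
  finally show ?thesis
    unfolding backup_def using mult_left_mono[OF _ discount_bounds(1)]
    by (smt (verit) distrib_left)
qed

text \<open>
  The contraction argument behind all comparisons of values: apply the hypothesis with \<open>c\<close> the
  maximum of \<open>d\<close> and solve for that maximum.
\<close>

lemma bellman_contraction:
  fixes d :: "'s \<Rightarrow> real"
  assumes "\<And>c s. (\<And>s. d s \<le> c) \<Longrightarrow> d s \<le> b + \<gamma> * c"
  shows "d s \<le> b / (1 - \<gamma>)"
proof -
  define m where "m = Max (range d)"
  have m: "d s \<le> m" for s by (simp add: m_def)
  have "m \<in> range d" unfolding m_def by (intro Max_in) auto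
  then obtain s0 where "d s0 = m" by auto
  with assms[of m s0] m have "m \<le> b + \<gamma> * m" by simp
  with discount_bounds have "m \<le> b / (1 - \<gamma>)" by (simp add: field_simps)
  with m[of s] show ?thesis by simp
qed

text \<open>
  The policy improvement theorem: following \<open>\<pi>'\<close> for one step loses nothing against \<open>\<pi>\<close>, and a
  deficit \<open>c\<close> after that step counts only as \<open>\<gamma> * c\<close>.
\<close>

lemma V_mono_of_improvement:
  assumes "\<And>s. V \<pi> s \<le> (\<Sum>a\<in>UNIV. pmf (\<pi>' s) a * Q \<pi> s a)"
  shows "V \<pi> \<le> V \<pi>'"
proof (rule le_funI)
  fix s
  have "V \<pi> s - V \<pi>' s \<le> 0 / (1 - \<gamma>)"
  proof (rule bellman_contraction)
    fix c s assume c: "\<And>s. V \<pi> s - V \<pi>' s \<le> c"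
    have "V \<pi> s \<le> (\<Sum>a\<in>UNIV. pmf (\<pi>' s) a * Q \<pi> s a)" by (rule assms)
    also have "\<dots> \<le> (\<Sum>a\<in>UNIV. pmf (\<pi>' s) a * (Q \<pi>' s a + \<gamma> * c))"
      unfolding Q_eq_backup_V by (intro average_mono backup_le_add c)
    also have "\<dots> = V \<pi>' s + \<gamma> * c"
      by (simp add: distrib_left sum.distrib sum_distrib_right[symmetric] sum_pmf_eq_1 V_eq_average_Q)
    finally show "V \<pi> s - V \<pi>' s \<le> 0 + \<gamma> * c" by simp
  qed
  then show "V \<pi> s \<le> V \<pi>' s" by simp
qed

lemma V_le_of_backup_le:
  assumes "\<And>s a. backup W s a \<le> W s"
  shows "V \<pi> s \<le> W s"
proof -
  have "V \<pi> s - W s \<le> 0 / (1 - \<gamma>)"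
  proof (rule bellman_contraction)
    fix c s assume c: "\<And>s. V \<pi> s - W s \<le> c"
    have "Q \<pi> s a \<le> W s + \<gamma> * c" for a
      unfolding Q_eq_backup_V using backup_le_add[of "V \<pi>" W c s a, OF c] assms[of s a] by simp
    then have "V \<pi> s \<le> W s + \<gamma> * c"
      unfolding V_eq_average_Q by (rule average_le)
    then show "V \<pi> s - W s \<le> 0 + \<gamma> * c" by simp
  qed
  then show ?thesis by simp
qed

abbreviation "V\<^sub>o \<equiv> V_opt P r \<gamma>"
abbreviation "Q\<^sub>o \<equiv> Q_opt P r \<gamma>"

lemma bdd_above_V: "bdd_above (range (\<lambda>\<pi>. V \<pi> s))"
  by (rule bdd_aboveI2[where M="1 / (1 - \<gamma>)"]) (rule V_bounds)

lemma V_le_V_opt: "V \<pi> s \<le> V\<^sub>o s"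
  unfolding V_opt_def by (rule cSUP_upper[OF UNIV_I bdd_above_V])

lemma V_opt_bounds: "0 \<le> V\<^sub>o s" "V\<^sub>o s \<le> 1 / (1 - \<gamma>)"
proof -
  show "0 \<le> V\<^sub>o s" using V_bounds(1) V_le_V_opt by (rule order_trans)
  show "V\<^sub>o s \<le> 1 / (1 - \<gamma>)" unfolding V_opt_def by (intro cSUP_least V_bounds) auto
qed

lemma tendsto_backup:
  assumes "\<And>s. (\<lambda>k. v k s) \<longlonglongrightarrow> w s"
  shows "(\<lambda>k. backup (v k) s a) \<longlonglongrightarrow> backup w s a"
  unfolding backup_def by (intro tendsto_intros assms)

text \<open>
  The optimal values are identified without constructing an optimal policy: a solution of the
  optimality equation bounds all policy values from above, and a sequence of policies that
  approaches it shows that it is their supremum.  The same sequence serves for the action values.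
\<close>

lemma optimal_values_of_limit:
  assumes lim: "\<And>s. (\<lambda>k. V (\<pi> k) s) \<longlonglongrightarrow> W s"
    and fixpoint: "\<And>s. W s = (MAX a. backup W s a)"
  shows "V\<^sub>o s = W s" and "Q\<^sub>o s a = backup W s a"
proof -
  have le: "V \<pi>' s \<le> W s" for \<pi>' s
    by (rule V_le_of_backup_le) (subst fixpoint, simp)
  show "V\<^sub>o s = W s"
  proof (rule antisym)
    show "V\<^sub>o s \<le> W s" unfolding V_opt_def by (intro cSUP_least le) auto
    show "W s \<le> V\<^sub>o s" by (rule LIMSEQ_le_const2[OF lim]) (auto simp: V_le_V_opt)
  qed
  have leQ: "Q \<pi>' s a \<le> backup W s a" for \<pi>'
    unfolding Q_eq_backup_V by (intro backup_mono le_funI le)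
  show "Q\<^sub>o s a = backup W s a"
  proof (rule antisym)
    show "Q\<^sub>o s a \<le> backup W s a" unfolding Q_opt_def by (intro cSUP_least leQ) auto
    have "Q (\<pi> k) s a \<le> Q\<^sub>o s a" for k
      unfolding Q_opt_def by (rule cSUP_upper) (auto intro!: bdd_aboveI2 leQ)
    then show "backup W s a \<le> Q\<^sub>o s a"
      unfolding Q_eq_backup_V
      using LIMSEQ_le_const2[OF tendsto_backup[of "\<lambda>k. V (\<pi> k)" W, OF lim]] by blast
  qed
qed

end

section \<open>Scalar mirror maps that are steep at 0 but not at 1\<close>

text \<open>
  A derivative takes the value of each difference quotient at an intermediate point, so it comes
  arbitrarily close to \<open>f' x\<close> on both sides of \<open>x\<close>; a monotone function with this property has no
  jump at \<open>x\<close>.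
\<close>

lemma deriv_strict_mono_continuous:
  fixes f :: "real \<Rightarrow> real"
  assumes I: "open I" and conv: "convex I"
    and diff: "\<And>x. x \<in> I \<Longrightarrow> (f has_real_derivative f' x) (at x)"
    and mono: "\<And>x y. x \<in> I \<Longrightarrow> y \<in> I \<Longrightarrow> x < y \<Longrightarrow> f' x < f' y"
    and x: "x \<in> I"
  shows "isCont f' x"
proof -
  have quot: "((\<lambda>y. (f y - f x) / (y - x)) \<longlongrightarrow> f' x) (at x)"
    using diff[OF x] by (simp add: has_field_derivative_iff)
  have evI: "eventually (\<lambda>y. y \<in> I) (at x)"
    using I x by (rule eventually_at_in_open')
  have mvt: "\<exists>z. min x y < z \<and> z < max x y \<and> z \<in> I \<and> (f y - f x) / (y - x) = f' z"
    if y: "y \<in> I" "y \<noteq> x" for y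
  proof -
    define l h where "l = min x y" and "h = max x y"
    have lh: "l < h" "l \<in> I" "h \<in> I" and sw: "l = x \<and> h = y \<or> l = y \<and> h = x"
      using y x by (auto simp: l_def h_def min_def max_def)
    have sub: "z \<in> I" if "l \<le> z" "z \<le> h" for z
      using that lh conv mem_is_interval_1_I[of I l h z] by (simp add: is_interval_convex_1)
    obtain z where z: "l < z" "z < h" "f h - f l = (h - l) * f' z"
      using MVT2[of l h f f'] sub diff lh(1) by blast
    have "(f y - f x) / (y - x) = (f h - f l) / (h - l)"
      using sw lh(1) by (auto simp: field_simps)
    with z lh(1) have "(f y - f x) / (y - x) = f' z" by simp
    with z sub[of z] show ?thesis unfolding l_def h_def by auto
  qed
  have "(f' \<longlongrightarrow> f' x) (at x)"
  proof (rule order_tendstoI)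
    fix c assume "c < f' x"
    with quot evI have "eventually (\<lambda>y. c < (f y - f x) / (y - x) \<and> y \<in> I) (at x)"
      by (auto dest: order_tendstoD intro: eventually_conj)
    then have "eventually (\<lambda>y. c < (f y - f x) / (y - x) \<and> y \<in> I) (at_left x)"
      by (rule filter_leD[rotated]) (simp add: at_le)
    moreover have "eventually (\<lambda>y. y < x) (at_left x)" by (simp add: eventually_at_filter)
    ultimately have "eventually (\<lambda>y. (c < (f y - f x) / (y - x) \<and> y \<in> I) \<and> y < x) (at_left x)"
      by (rule eventually_conj)
    then obtain y where y: "c < (f y - f x) / (y - x)" "y \<in> I" "y < x"
      using eventually_happens'[OF trivial_limit_at_left_real] by blast
    with mvt[of y] obtain z where z: "z \<in> I" "z < x" "c < f' z" by auto
    have "eventually (\<lambda>w. z < w) (at x)" using z by (intro order_tendstoD) auto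
    with evI show "eventually (\<lambda>w. c < f' w) (at x)"
    proof eventually_elim
      case (elim w)
      then show ?case using z(3) mono[of z w] z(1) by simp
    qed
  next
    fix c assume "f' x < c"
    with quot evI have "eventually (\<lambda>y. (f y - f x) / (y - x) < c \<and> y \<in> I) (at x)"
      by (auto dest: order_tendstoD intro: eventually_conj)
    then have "eventually (\<lambda>y. (f y - f x) / (y - x) < c \<and> y \<in> I) (at_right x)"
      by (rule filter_leD[rotated]) (simp add: at_le)
    moreover have "eventually (\<lambda>y. x < y) (at_right x)" by (simp add: eventually_at_filter)
    ultimately have "eventually (\<lambda>y. ((f y - f x) / (y - x) < c \<and> y \<in> I) \<and> x < y) (at_right x)"
      by (rule eventually_conj)
    then obtain y where y: "(f y - f x) / (y - x) < c" "y \<in> I" "x < y"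
      using eventually_happens'[OF trivial_limit_at_right_real] by blast
    with mvt[of y] obtain z where z: "z \<in> I" "x < z" "f' z < c" by auto
    have "eventually (\<lambda>w. w < z) (at x)" using z by (intro order_tendstoD) auto
    with evI show "eventually (\<lambda>w. f' w < c) (at x)"
    proof eventually_elim
      case (elim w)
      then show ?case using z(3) mono[of w z] z(1) by simp
    qed
  qed
  then show ?thesis by (simp add: isCont_def)
qed

text \<open>
  Under the two boundary conditions \<open>-\<psi>'\<close> maps \<open>(0,1]\<close> bijectively onto a closed half-line that
  is unbounded above: the domain of \<open>\<psi>\<close> ends at \<open>0\<close> but extends beyond \<open>1\<close>.
\<close>

locale steep_mirror_map =
  fixes \<psi> :: "real \<Rightarrow> ereal" and d1 :: ereal
  assumes mirror: "mirror_map \<psi>"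
    and deriv_0: "((\<lambda>x. ereal (ederiv \<psi> x)) \<longlongrightarrow> -\<infinity>) (at_right 0)"
    and deriv_1: "((\<lambda>x. ereal (ederiv \<psi> x)) \<longlongrightarrow> d1) (at_left 1)" "d1 < \<infinity>"
begin

definition f where "f x = real_of_ereal (\<psi> x)"

abbreviation "f' \<equiv> ederiv \<psi>"
abbreviation "I \<equiv> interior (eff_dom \<psi>)"

lemma unit_interval_in_dom: "{0..1} \<subseteq> eff_dom \<psi>"
  using mirror by (simp add: mirror_map_def)

lemma psi_eq_f: "x \<in> eff_dom \<psi> \<Longrightarrow> \<psi> x = ereal (f x)"
  using mirror by (cases "\<psi> x") (auto simp: mirror_map_def eff_dom_def f_def)

lemma convex_dom: "convex (eff_dom \<psi>)"
  and convex_on_f: "convex_on (eff_dom \<psi>) f"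
proof -
  have key: "(1 - t) * x + t * y \<in> eff_dom \<psi> \<and> f ((1 - t) * x + t * y) \<le> (1 - t) * f x + t * f y"
    if xy: "x \<in> eff_dom \<psi>" "y \<in> eff_dom \<psi>" and t: "0 \<le> t" "t \<le> 1" for x y t
  proof -
    have "(x, f x) \<in> ereal_epigraph \<psi>" "(y, f y) \<in> ereal_epigraph \<psi>"
      using xy by (simp_all add: ereal_epigraph_def psi_eq_f)
    then have "(1 - t) *\<^sub>R (x, f x) + t *\<^sub>R (y, f y) \<in> ereal_epigraph \<psi>"
      using mirror t by (intro convexD) (auto simp: mirror_map_def)
    then have le: "\<psi> ((1 - t) * x + t * y) \<le> ereal ((1 - t) * f x + t * f y)"
      by (simp add: ereal_epigraph_def)
    then have "(1 - t) * x + t * y \<in> eff_dom \<psi>"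
      by (auto simp: eff_dom_def intro: le_less_trans)
    with le show ?thesis by (simp add: psi_eq_f)
  qed
  show "convex (eff_dom \<psi>)"
    unfolding convex_alt using key by simp
  then show "convex_on (eff_dom \<psi>) f" by (intro convex_onI) (use key in auto)
qed

lemma open_unit_interval_in_I: "{0<..<1} \<subseteq> I"
  using unit_interval_in_dom by (intro interior_maximal) auto

lemma convex_I: "convex I"
  by (intro convex_interior convex_dom)

lemma f_has_derivative: "x \<in> I \<Longrightarrow> (f has_real_derivative f' x) (at x)"
proof -
  assume x: "x \<in> I"
  have "f = (\<lambda>x. real_of_ereal (\<psi> x))" by (simp add: fun_eq_iff f_def)
  moreover have "f differentiable at x"
    using mirror x unfolding calculation mirror_map_def differentiable_on_def
    by (metis at_within_interior interior_interior)
  ultimately show ?thesis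
    by (metis DERIV_deriv_iff_real_differentiable ederiv_def)
qed

lemma tangent_below: "x \<in> I \<Longrightarrow> y \<in> eff_dom \<psi> \<Longrightarrow> f' x * (y - x) \<le> f y - f x"
  by (rule convex_on_imp_above_tangent[OF convex_on_f])
     (auto intro: convex_connected convex_dom has_field_derivative_at_within f_has_derivative)

text \<open>
  The tangents at \<open>x\<close> and \<open>y\<close> both lie below \<open>f\<close> at the midpoint, which by strict convexity is below
  the chord.
\<close>

lemma f'_strict_mono:
  assumes "x \<in> I" "y \<in> I" "x < y"
  shows "f' x < f' y"
proof -
  define m where "m = (1 - 1 / 2) * x + 1 / 2 * y"
  have m: "m - x = (y - x) / 2" "m - y = - (y - x) / 2" by (simp_all add: m_def field_simps)
  have mI: "m \<in> eff_dom \<psi>"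
    using convexD[OF convex_dom, of x y "1 / 2" "1 / 2"] assms interior_subset[of "eff_dom \<psi>"]
    by (auto simp: m_def)
  have "f m < (1 - 1 / 2) * f x + 1 / 2 * f y"
    using mirror assms unfolding mirror_map_def strictly_convex_on_def f_def m_def
    by (elim conjE ballE[of _ _ x] ballE[of _ _ y] allE[of _ "1 / 2"]) auto
  moreover have "f' x * (m - x) \<le> f m - f x" "f' y * (m - y) \<le> f m - f y"
    using assms mI by (auto intro: tangent_below)
  ultimately have "(y - x) * f' x < (y - x) * f' y"
    unfolding m by (simp add: field_simps)
  with \<open>x < y\<close> show ?thesis by simp
qed

lemma f'_mono: "x \<in> I \<Longrightarrow> y \<in> I \<Longrightarrow> x \<le> y \<Longrightarrow> f' x \<le> f' y"
  using f'_strict_mono[of x y] by (cases "x = y") auto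

lemma isCont_f': "x \<in> I \<Longrightarrow> isCont f' x"
  by (rule deriv_strict_mono_continuous[OF open_interior convex_I f_has_derivative f'_strict_mono])

lemma f'_tendsto_0: "filterlim f' at_bot (at_right 0)"
  using deriv_0 by (simp add: tendsto_MInfty filterlim_at_bot_dense)

text \<open>
  Near an interior point the increasing function \<open>\<psi>'\<close> is bounded below.
\<close>

lemma zero_notin_I: "0 \<notin> I"
proof
  assume 0: "0 \<in> I"
  have "eventually (\<lambda>x. f' x < f' 0) (at_right 0)"
    using f'_tendsto_0 by (simp add: filterlim_at_bot_dense)
  moreover have "eventually (\<lambda>x. x \<in> {0<..<1::real}) (at_right 0)"
    by (rule eventually_at_right_real) simp
  ultimately have "eventually (\<lambda>x::real. False) (at_right 0)"
  proof eventually_elim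
    case (elim x)
    with f'_mono[OF 0, of x] subsetD[OF open_unit_interval_in_I, of x] show ?case by simp
  qed
  then show False by simp
qed

text \<open>
  If \<open>1\<close> were a boundary point of the domain, \<open>\<psi>'\<close> would blow up there; but on \<open>[1/2,1)\<close> it is
  increasing and has a limit below \<open>\<infinity>\<close>, hence is bounded.
\<close>

lemma one_in_I: "1 \<in> I"
proof (rule ccontr)
  assume n1: "1 \<notin> I"
  have "1 \<in> eff_dom \<psi>" using unit_interval_in_dom by auto
  then have fr: "1 \<in> frontier (eff_dom \<psi>)"
    using n1 closure_subset by (auto simp: frontier_def)
  define X where "X n = 1 - 1 / (real n + 2)" for n
  have X: "X n \<in> {1/2..<1}" for n by (auto simp: X_def field_simps)
  have XI: "X n \<in> I" for n using X[of n] open_unit_interval_in_I by auto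
  have X1: "X \<longlonglongrightarrow> 1" unfolding X_def by real_asymp
  have "filterlim X (at_left 1) sequentially"
    using X1 X by (auto simp: filterlim_at less_imp_neq)
  then have lim: "(\<lambda>n. ereal (f' (X n))) \<longlonglongrightarrow> d1"
    using deriv_1(1) by (rule filterlim_compose[rotated])
  have "ereal (f' (1/2)) \<le> d1"
  proof (rule LIMSEQ_le_const[OF lim])
    have "f' (1 / 2) \<le> f' (X n)" for n
      by (rule f'_mono) (use X[of n] XI open_unit_interval_in_I in auto)
    then show "\<exists>N. \<forall>n\<ge>N. ereal (f' (1 / 2)) \<le> ereal (f' (X n))" by simp
  qed
  with deriv_1(2) obtain d where d: "d1 = ereal d" by (cases d1) auto
  with lim have "(\<lambda>n. f' (X n)) \<longlonglongrightarrow> d" by simp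
  then have "(\<lambda>n. \<bar>f' (X n)\<bar>) \<longlonglongrightarrow> \<bar>d\<bar>" by (rule tendsto_rabs)
  moreover have "filterlim (\<lambda>n. \<bar>f' (X n)\<bar>) at_top sequentially"
    using mirror XI fr X1 unfolding mirror_map_def by blast
  ultimately show False
    using not_tendsto_and_filterlim_at_infinity[OF sequentially_bot]
      filterlim_at_top_imp_at_infinity by blast
qed

lemma half_open_unit_interval_in_I: "{0<..1} \<subseteq> I"
  using open_unit_interval_in_I one_in_I by (auto simp: less_le)

lemma in_I_imp_pos: "0 \<le> x \<Longrightarrow> x \<in> I \<Longrightarrow> 0 < x"
  using zero_notin_I by (cases "x = 0") auto

lemma d1_eq: "d1 = ereal (f' 1)"
proof -
  have "(f' \<longlongrightarrow> f' 1) (at_left 1)"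
    using isCont_f'[OF one_in_I] by (auto simp: isCont_def intro: filterlim_mono at_le)
  then have "((\<lambda>x. ereal (f' x)) \<longlongrightarrow> ereal (f' 1)) (at_left 1)" by simp
  with deriv_1(1) show ?thesis by (intro tendsto_unique) auto
qed

lemma continuous_on_phi: "continuous_on {0<..1} (phi \<psi>)"
  unfolding phi_def using half_open_unit_interval_in_I
  by (intro continuous_intros continuous_at_imp_continuous_on) (auto intro: isCont_f')

lemma strict_antimono_phi: "strict_antimono_on {0<..1} (phi \<psi>)"
  using subsetD[OF half_open_unit_interval_in_I]
  by (intro monotone_onI) (simp add: phi_def f'_strict_mono)

lemma phi_less_iff: "0 < x \<Longrightarrow> x \<le> 1 \<Longrightarrow> 0 < y \<Longrightarrow> y \<le> 1 \<Longrightarrow> phi \<psi> x < phi \<psi> y \<longleftrightarrow> y < x"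
  using f'_strict_mono[of x y] f'_strict_mono[of y x] subsetD[OF half_open_unit_interval_in_I, of x]
    subsetD[OF half_open_unit_interval_in_I, of y]
  by (cases x y rule: linorder_cases) (auto simp: phi_def)

lemma phi_le_iff: "0 < x \<Longrightarrow> x \<le> 1 \<Longrightarrow> 0 < y \<Longrightarrow> y \<le> 1 \<Longrightarrow> phi \<psi> x \<le> phi \<psi> y \<longleftrightarrow> y \<le> x"
  using phi_less_iff[of y x] by (simp add: not_less[symmetric])

lemma image_phi: "phi \<psi> ` {0<..1} = {phi \<psi> 1..}"
proof
  show "phi \<psi> ` {0<..1} \<subseteq> {phi \<psi> 1..}" by (auto simp: phi_le_iff)
  show "{phi \<psi> 1..} \<subseteq> phi \<psi> ` {0<..1}"
  proof
    fix y assume y: "y \<in> {phi \<psi> 1..}"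
    have "eventually (\<lambda>x. f' x < - y) (at_right 0)"
      using f'_tendsto_0 by (simp add: filterlim_at_bot_dense)
    moreover have "eventually (\<lambda>x. x \<in> {0<..<1::real}) (at_right 0)"
      by (rule eventually_at_right_real) simp
    ultimately have "eventually (\<lambda>x. f' x < - y \<and> x \<in> {0<..<1}) (at_right 0)"
      by (rule eventually_conj)
    from eventually_happens'[OF trivial_limit_at_right_real this]
    obtain x where x: "f' x < - y" "0 < x" "x < 1" by auto
    have "\<exists>z\<ge>x. z \<le> 1 \<and> phi \<psi> z = y"
    proof (rule IVT2')
      show "continuous_on {x..1} (phi \<psi>)"
        by (rule continuous_on_subset[OF continuous_on_phi]) (use x in auto)
    qed (use x y in \<open>auto simp: phi_def\<close>)
    then obtain z where "x \<le> z" "z \<le> 1" "phi \<psi> z = y" by blast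
    with x show "y \<in> phi \<psi> ` {0<..1}" by (intro image_eqI[of _ _ z]) auto
  qed
qed

lemma phi_inv_works:
  assumes "phi \<psi> 1 \<le> y"
  shows "0 < phi_inv \<psi> y" "phi_inv \<psi> y \<le> 1" "phi \<psi> (phi_inv \<psi> y) = y"
proof -
  have inj: "inj_on (phi \<psi>) {0<..1}"
  proof (rule inj_onI)
    fix x y assume "x \<in> {0<..1}" "y \<in> {0<..1}" "phi \<psi> x = phi \<psi> y"
    then show "x = y" using phi_le_iff[of x y] phi_le_iff[of y x] by simp
  qed
  have y: "y \<in> phi \<psi> ` {0<..1}" using assms by (simp add: image_phi)
  show "phi \<psi> (phi_inv \<psi> y) = y"
    unfolding phi_inv_def by (rule f_the_inv_into_f[OF inj y])
  have "phi_inv \<psi> y \<in> {0<..1}"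
    unfolding phi_inv_def by (rule the_inv_into_into[OF inj y order_refl])
  then show "0 < phi_inv \<psi> y" "phi_inv \<psi> y \<le> 1" by auto
qed

lemma le_phi_inv_iff: "0 < x \<Longrightarrow> x \<le> 1 \<Longrightarrow> phi \<psi> 1 \<le> y \<Longrightarrow> x \<le> phi_inv \<psi> y \<longleftrightarrow> y \<le> phi \<psi> x"
  using phi_inv_works[of y] phi_le_iff[of "phi_inv \<psi> y" x] by simp

lemma phi_inv_le_iff: "0 < x \<Longrightarrow> x \<le> 1 \<Longrightarrow> phi \<psi> 1 \<le> y \<Longrightarrow> phi_inv \<psi> y \<le> x \<longleftrightarrow> phi \<psi> x \<le> y"
  using phi_inv_works[of y] phi_le_iff[of x "phi_inv \<psi> y"] by simp

end

section \<open>Optimality conditions for one mirror descent step\<close>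

lemma frechet_derivative_separable:
  fixes q :: "real ^ 'a::finite"
  assumes "\<And>a. (f has_real_derivative f' (q $ a)) (at (q $ a))"
  shows "frechet_derivative (\<lambda>x. \<Sum>a\<in>UNIV. f (x $ a)) (at q) = (\<lambda>v. \<Sum>a\<in>UNIV. f' (q $ a) * v $ a)"
proof (rule frechet_derivative_at[symmetric], rule has_derivative_sum)
  fix a
  have "((\<lambda>x. x $ a) has_derivative (\<lambda>v. v $ a)) (at q)"
    by (intro bounded_linear_imp_has_derivative bounded_linear_vec_nth)
  from has_derivative_compose[OF this assms[of a, unfolded has_field_derivative_def]]
  show "((\<lambda>x. f (x $ a)) has_derivative (\<lambda>v. f' (q $ a) * v $ a)) (at q)"
    by simp
qed

text \<open>
  The perturbations used to derive the first-order conditions on the simplex.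
\<close>

lemma obtain_mass_exchange:
  fixes p :: "'a::finite pmf"
  assumes "a \<noteq> b" "0 \<le> e" "e \<le> pmf p b"
  obtains p' where "pmf p' a = pmf p a + e" "pmf p' b = pmf p b - e"
    "\<And>x. x \<noteq> a \<Longrightarrow> x \<noteq> b \<Longrightarrow> pmf p' x = pmf p x"
proof -
  define g where "g x = pmf p x + (if x = a then e else 0) - (if x = b then e else 0)" for x
  have nn: "0 \<le> g x" for x using assms by (auto simp: g_def)
  have "(\<Sum>x\<in>UNIV. g x) = 1"
    by (simp add: g_def sum.distrib sum_subtractf sum_pmf_eq_1)
  then have "(\<integral>\<^sup>+x. g x \<partial>count_space UNIV) = 1"
    by (simp add: nn_integral_count_space_finite sum_ennreal nn)
  from pmf_embed_pmf[of g, OF nn this] have "pmf (embed_pmf g) x = g x" for x .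
  with assms(1) show ?thesis by (intro that[of "embed_pmf g"]) (simp_all add: g_def)
qed

lemma eventually_small_at_right: "0 < c \<Longrightarrow> eventually (\<lambda>e::real. 0 < e \<and> e < c) (at_right 0)"
  using eventually_at_right_real[of 0 c] by simp

context steep_mirror_map
begin

text \<open>
  Moving mass \<open>e\<close> from \<open>b\<close> to \<open>a\<close> does not increase the objective.  Bounding the change of \<open>\<psi>\<close> by
  its tangents at the points reached, which lie in the interior of the domain even when \<open>p a = 0\<close>,
  gives a form of the first-order condition that holds before the support of \<open>p\<close> is known.
\<close>

lemma exchange_inequality:
  fixes p q :: "'a::finite pmf" and g :: "'a \<Rightarrow> real"
  assumes q: "\<And>a. pmf q a \<in> I"
    and max: "is_arg_max
        (\<lambda>p. \<eta> * (vec_of_pmf p \<bullet> (\<chi> a. g a)) - bregman (sep_map \<psi>) (vec_of_pmf p) (vec_of_pmf q))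
        (\<lambda>_. True) p"
    and ab: "a \<noteq> b" and e: "0 < e" "e < pmf p b"
  shows "\<eta> * (g a - g b) + f' (pmf q a) - f' (pmf q b) \<le> f' (pmf p a + e) - f' (pmf p b - e)"
proof -
  \<comment> \<open>Up to a constant the objective is the separable sum of these functions of the coordinates.\<close>
  define F where "F x t = \<eta> * g x * t - f t + f' (pmf q x) * t" for x t
  define c where "c = (\<Sum>x\<in>UNIV. f (pmf q x) - f' (pmf q x) * pmf q x)"
  have J: "\<eta> * (vec_of_pmf p \<bullet> (\<chi> a. g a)) - bregman (sep_map \<psi>) (vec_of_pmf p) (vec_of_pmf q)
      = (\<Sum>x\<in>UNIV. F x (pmf p x)) + c" for p
  proof -
    have sep: "sep_map \<psi> = (\<lambda>x. \<Sum>a\<in>UNIV. f (x $ a))"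
      by (simp add: sep_map_def f_def fun_eq_iff)
    have D: "frechet_derivative (sep_map \<psi>) (at (vec_of_pmf q))
        = (\<lambda>v. \<Sum>a\<in>UNIV. f' (vec_of_pmf q $ a) * v $ a)"
      unfolding sep by (rule frechet_derivative_separable) (simp add: vec_of_pmf_def f_has_derivative q)
    show ?thesis
      unfolding bregman_def D unfolding sep
      by (simp add: vec_of_pmf_def inner_vec_def F_def c_def sum_distrib_left sum.distrib
          sum_subtractf right_diff_distrib mult_ac)
  qed
  obtain p' where p': "pmf p' a = pmf p a + e" "pmf p' b = pmf p b - e"
      "\<And>x. x \<noteq> a \<Longrightarrow> x \<noteq> b \<Longrightarrow> pmf p' x = pmf p x"
    using obtain_mass_exchange[of a b e p] ab e by auto
  have "(\<Sum>x\<in>UNIV. F x (pmf p' x)) \<le> (\<Sum>x\<in>UNIV. F x (pmf p x))"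
    using max by (simp add: is_arg_max_linorder J)
  then have "(\<Sum>x\<in>UNIV. F x (pmf p' x) - F x (pmf p x)) \<le> 0"
    by (simp add: sum_subtractf)
  also have "(\<Sum>x\<in>UNIV. F x (pmf p' x) - F x (pmf p x)) = (\<Sum>x\<in>{a, b}. F x (pmf p' x) - F x (pmf p x))"
    using p'(3) by (intro sum.mono_neutral_right) auto
  finally have "F a (pmf p a + e) - F a (pmf p a) + (F b (pmf p b - e) - F b (pmf p b)) \<le> 0"
    using ab by (simp add: p')
  then have 1: "e * (\<eta> * (g a - g b) + f' (pmf q a) - f' (pmf q b))
      \<le> f (pmf p a + e) - f (pmf p a) + (f (pmf p b - e) - f (pmf p b))"
    by (simp add: F_def algebra_simps)
  have p_dom: "pmf p x \<in> eff_dom \<psi>" for x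
    using unit_interval_in_dom by (auto simp: pmf_le_1)
  have "pmf p a + e \<le> 1" using pmf_le_1[of p' a] p'(1) by simp
  then have "pmf p a + e \<in> I" "pmf p b - e \<in> I"
    using e pmf_le_1[of p b] add_nonneg_pos[OF pmf_nonneg[of p a] e(1)]
    by (auto intro!: subsetD[OF half_open_unit_interval_in_I])
  from tangent_below[OF this(1) p_dom[of a]] tangent_below[OF this(2) p_dom[of b]]
  have "f (pmf p a + e) - f (pmf p a) \<le> e * f' (pmf p a + e)"
      "f (pmf p b - e) - f (pmf p b) \<le> - e * f' (pmf p b - e)"
    by (simp_all add: algebra_simps)
  with 1 have "e * (\<eta> * (g a - g b) + f' (pmf q a) - f' (pmf q b))
      \<le> e * (f' (pmf p a + e) - f' (pmf p b - e))"
    by (simp add: algebra_simps)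
  with e(1) show ?thesis by simp
qed

text \<open>
  If \<open>a\<close> had no mass, the right-hand side of the exchange inequality would tend to \<open>-\<infinity>\<close> as
  \<open>e\<close> tends to \<open>0\<close>, for any \<open>b\<close> in the support.
\<close>

lemma mirror_step_interior:
  fixes p q :: "'a::finite pmf" and g :: "'a \<Rightarrow> real"
  assumes q: "\<And>a. pmf q a \<in> I"
    and max: "is_arg_max
        (\<lambda>p. \<eta> * (vec_of_pmf p \<bullet> (\<chi> a. g a)) - bregman (sep_map \<psi>) (vec_of_pmf p) (vec_of_pmf q))
        (\<lambda>_. True) p"
  shows "0 < pmf p a"
proof (rule ccontr)
  assume "\<not> 0 < pmf p a"
  then have a0: "pmf p a = 0" by (simp add: pmf_nonneg antisym not_less)
  obtain b where b: "0 < pmf p b"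
    using set_pmf_not_empty[of p] by (auto simp: pmf_positive_iff)
  then have ab: "a \<noteq> b" using a0 by auto
  define K where "K = \<eta> * (g a - g b) + f' (pmf q a) - f' (pmf q b) + f' (pmf p b / 2)"
  have "eventually (\<lambda>e. f' e < K) (at_right 0)"
    using f'_tendsto_0 by (simp add: filterlim_at_bot_dense)
  moreover have "eventually (\<lambda>e. 0 < e \<and> e < pmf p b / 2) (at_right 0)"
    using b by (intro eventually_small_at_right) simp
  ultimately have "eventually (\<lambda>e. False) (at_right (0::real))"
  proof eventually_elim
    case (elim e)
    have "f' (pmf p b / 2) \<le> f' (pmf p b - e)"
      using elim b pmf_le_1[of p b]
      by (intro f'_mono subsetD[OF half_open_unit_interval_in_I]) auto
    with exchange_inequality[OF q max ab, of e] elim a0 b show ?case by (simp add: K_def)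
  qed
  then show False by simp
qed

text \<open>
  As all masses are positive, \<open>e\<close> may tend to \<open>0\<close> in the exchange inequality for \<open>(a, b)\<close> and for
  \<open>(b, a)\<close>; the two limits are opposite inequalities.
\<close>

lemma mirror_step_stationary:
  fixes p q :: "'a::finite pmf" and g :: "'a \<Rightarrow> real"
  assumes q: "\<And>a. pmf q a \<in> I"
    and max: "is_arg_max
        (\<lambda>p. \<eta> * (vec_of_pmf p \<bullet> (\<chi> a. g a)) - bregman (sep_map \<psi>) (vec_of_pmf p) (vec_of_pmf q))
        (\<lambda>_. True) p"
  shows "phi \<psi> (pmf p a) - phi \<psi> (pmf p b) = phi \<psi> (pmf q a) - phi \<psi> (pmf q b) - \<eta> * (g a - g b)"
proof -
  have le: "\<eta> * (g a - g b) + f' (pmf q a) - f' (pmf q b) \<le> f' (pmf p a) - f' (pmf p b)"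
    if ab: "a \<noteq> b" for a b
  proof (rule tendsto_lowerbound)
    have pI: "pmf p x \<in> I" for x
      using mirror_step_interior[OF q max] by (intro subsetD[OF half_open_unit_interval_in_I]) (auto simp: pmf_le_1)
    have "((\<lambda>e. pmf p a + e) \<longlongrightarrow> pmf p a + 0) (at_right 0)"
         "((\<lambda>e. pmf p b - e) \<longlongrightarrow> pmf p b - 0) (at_right 0)"
      by (intro tendsto_intros)+
    then show "((\<lambda>e. f' (pmf p a + e) - f' (pmf p b - e)) \<longlongrightarrow> f' (pmf p a) - f' (pmf p b)) (at_right 0)"
      by (intro tendsto_diff isCont_tendsto_compose[OF isCont_f'] pI) simp_all
    show "eventually (\<lambda>e. \<eta> * (g a - g b) + f' (pmf q a) - f' (pmf q b)
        \<le> f' (pmf p a + e) - f' (pmf p b - e)) (at_right 0)"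
      using eventually_small_at_right[OF mirror_step_interior[OF q max, of b]]
      by eventually_elim (rule exchange_inequality[OF q max ab], auto)
  qed simp
  show ?thesis
    using le[of a b] le[of b a] by (cases "a = b") (auto simp: phi_def algebra_simps)
qed

text \<open>
  By stationarity \<open>\<eta> g\<close> is \<open>\<phi>(q) - \<phi>(p)\<close> up to a constant, the constant is annihilated by \<open>p - q\<close>,
  and \<open>(p - q) (\<phi>(q) - \<phi>(p))\<close> is nonnegative in each coordinate because \<open>\<phi>\<close> is decreasing.
\<close>

lemma mirror_step_improves:
  fixes p q :: "'a::finite pmf" and g :: "'a \<Rightarrow> real"
  assumes q: "\<And>a. pmf q a \<in> I" and \<eta>: "0 < \<eta>"
    and max: "is_arg_max
        (\<lambda>p. \<eta> * (vec_of_pmf p \<bullet> (\<chi> a. g a)) - bregman (sep_map \<psi>) (vec_of_pmf p) (vec_of_pmf q))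
        (\<lambda>_. True) p"
  shows "(\<Sum>a\<in>UNIV. pmf q a * g a) \<le> (\<Sum>a\<in>UNIV. pmf p a * g a)"
proof -
  \<comment> \<open>The multiplier of the simplex constraint is read off at an arbitrary action.\<close>
  fix b :: 'a
  define c where "c = phi \<psi> (pmf q b) - phi \<psi> (pmf p b) - \<eta> * g b"
  have g: "\<eta> * g a = phi \<psi> (pmf q a) - phi \<psi> (pmf p a) - c" for a
    using mirror_step_stationary[OF q max, of a b] by (simp add: c_def algebra_simps)
  have "0 \<le> (pmf p a - pmf q a) * (phi \<psi> (pmf q a) - phi \<psi> (pmf p a))" for a
    using mirror_step_interior[OF q max, of a] in_I_imp_pos[OF _ q, of a]
    by (cases "pmf p a \<le> pmf q a") (simp_all add: pmf_le_1 phi_le_iff mult_nonpos_nonpos)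
  then have "0 \<le> (\<Sum>a\<in>UNIV. (pmf p a - pmf q a) * (phi \<psi> (pmf q a) - phi \<psi> (pmf p a)))"
    by (intro sum_nonneg)
  also have "\<dots> = (\<Sum>a\<in>UNIV. (pmf p a - pmf q a) * (\<eta> * g a + c))"
    by (simp add: g)
  also have "\<dots> = \<eta> * (\<Sum>a\<in>UNIV. (pmf p a - pmf q a) * g a) + (\<Sum>a\<in>UNIV. pmf p a - pmf q a) * c"
    by (simp add: distrib_left sum.distrib sum_distrib_left sum_distrib_right mult.left_commute)
  also have "(\<Sum>a\<in>UNIV. pmf p a - pmf q a) = 0"
    by (simp add: sum_subtractf sum_pmf_eq_1)
  finally have "0 \<le> (\<Sum>a\<in>UNIV. (pmf p a - pmf q a) * g a)"
    using \<eta> by (simp add: zero_le_mult_iff)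
  then show ?thesis by (simp add: left_diff_distrib sum_subtractf)
qed

end

section \<open>Gap and norm on finite types\<close>

lemma Q_opt_le_of_suboptimal:
  fixes P :: "'s::finite \<Rightarrow> 'a::finite \<Rightarrow> 's pmf"
  assumes a: "a \<notin> opt_actions P r \<gamma> s"
  shows "Q_opt P r \<gamma> s a \<le> V_opt P r \<gamma> s - gap P r \<gamma>"
proof -
  have "gap P r \<gamma> \<le> state_gap P r \<gamma> s"
    unfolding gap_def by (rule Min_le) (use a in \<open>auto simp: nontrivial_states_def\<close>)
  moreover have "Q_opt P r \<gamma> s a \<le> (MAX a \<in> - opt_actions P r \<gamma> s. Q_opt P r \<gamma> s a)"
    by (rule Max_ge) (use a in auto)
  ultimately show ?thesis by (simp add: state_gap_def)
qed

lemma gap_attained: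
  fixes P :: "'s::finite \<Rightarrow> 'a::finite \<Rightarrow> 's pmf"
  assumes "nontrivial_states P r \<gamma> \<noteq> {}"
  obtains s a where "Q_opt P r \<gamma> s a = V_opt P r \<gamma> s - gap P r \<gamma>"
proof -
  have "gap P r \<gamma> \<in> state_gap P r \<gamma> ` nontrivial_states P r \<gamma>"
    unfolding gap_def by (rule Min_in) (use assms in auto)
  then obtain s where s: "s \<in> nontrivial_states P r \<gamma>" "gap P r \<gamma> = state_gap P r \<gamma> s" by auto
  have "(MAX a \<in> - opt_actions P r \<gamma> s. Q_opt P r \<gamma> s a) \<in> Q_opt P r \<gamma> s ` (- opt_actions P r \<gamma> s)"
    by (rule Max_in) (use s(1) in \<open>auto simp: nontrivial_states_def\<close>)
  then obtain a where "(MAX a \<in> - opt_actions P r \<gamma> s. Q_opt P r \<gamma> s a) = Q_opt P r \<gamma> s a" by auto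
  with s(2) show ?thesis by (intro that[of s a]) (simp add: state_gap_def)
qed

lemma exists_pmf_ge_inverse_card:
  fixes p :: "'a::finite pmf"
  obtains b where "1 / real CARD('a) \<le> pmf p b"
proof (rule ccontr)
  assume "\<not> thesis"
  then have "pmf p b < 1 / real CARD('a)" for b using that by (meson not_le)
  then have "(\<Sum>b\<in>UNIV. pmf p b) < (\<Sum>b\<in>(UNIV::'a set). 1 / real CARD('a))"
    by (intro sum_strict_mono) auto
  then show False by (simp add: sum_pmf_eq_1)
qed

lemma sup_norm_le: "(\<And>s. \<bar>f s\<bar> \<le> c) \<Longrightarrow> sup_norm f \<le> c"
  and abs_le_sup_norm: "\<bar>f s\<bar> \<le> sup_norm f" for f :: "'s::finite \<Rightarrow> real"
  by (auto simp: sup_norm_def)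

section \<open>Convergence of policy mirror descent\<close>

locale pmd_run = discounted_mdp P r \<gamma> + steep_mirror_map \<psi> d1
  for P :: "'s::finite \<Rightarrow> 'a::finite \<Rightarrow> 's pmf" and r \<gamma> \<psi> d1 +
  fixes \<eta> :: real and \<pi> :: "nat \<Rightarrow> ('s, 'a) policy"
  assumes eta_pos: "0 < \<eta>"
    and pmd: "pmd_sequence P r \<gamma> \<psi> \<eta> \<pi>"
begin

abbreviation "\<phi> \<equiv> phi \<psi>"

lemma pmd_step: "is_arg_max
    (\<lambda>p. \<eta> * (vec_of_pmf p \<bullet> (\<chi> a. Q (\<pi> k) s a))
         - bregman (sep_map \<psi>) (vec_of_pmf p) (vec_of_pmf (\<pi> k s))) (\<lambda>_. True) (\<pi> (Suc k) s)"
  using pmd by (simp add: pmd_sequence_def)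

lemma iterate_in_I: "pmf (\<pi> k s) a \<in> I"
proof (induction k arbitrary: a)
  case 0
  then show ?case using pmd by (simp add: pmd_sequence_def)
next
  case (Suc k)
  have "0 < pmf (\<pi> (Suc k) s) a" by (rule mirror_step_interior[OF Suc.IH pmd_step])
  then show ?case by (intro subsetD[OF half_open_unit_interval_in_I]) (simp add: pmf_le_1)
qed

lemma iterate_pos: "0 < pmf (\<pi> k s) a"
  by (rule in_I_imp_pos[OF pmf_nonneg iterate_in_I])

text \<open>
  Comparing two actions in the dual variables \<open>\<phi>(\<pi>\<^sub>k(a))\<close> eliminates the multiplier of the constraint
  that the masses sum to one.
\<close>

definition dual_gap where
  "dual_gap k s a b = \<phi> (pmf (\<pi> k s) a) - \<phi> (pmf (\<pi> k s) b)"

lemma dual_gap_swap: "dual_gap k s b a = - dual_gap k s a b"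
  by (simp add: dual_gap_def)

lemma dual_gap_Suc: "dual_gap (Suc k) s a b = dual_gap k s a b + \<eta> * (Q (\<pi> k) s b - Q (\<pi> k) s a)"
  using mirror_step_stationary[OF iterate_in_I pmd_step, of k s a b]
  by (simp add: dual_gap_def algebra_simps)

lemma dual_gap_ge:
  assumes "\<And>k. K \<le> k \<Longrightarrow> c \<le> Q (\<pi> k) s b - Q (\<pi> k) s a" and "K \<le> k"
  shows "dual_gap K s a b + \<eta> * c * (real k - real K) \<le> dual_gap k s a b"
  using \<open>K \<le> k\<close>
proof (induction k rule: dec_induct)
  case (step k)
  have "\<eta> * c \<le> \<eta> * (Q (\<pi> k) s b - Q (\<pi> k) s a)"
    using assms(1)[of k] step.hyps eta_pos by simp
  with step.IH show ?case by (simp add: dual_gap_Suc algebra_simps)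
qed simp

lemma dual_gap_le:
  assumes "\<And>k. K \<le> k \<Longrightarrow> Q (\<pi> k) s b - Q (\<pi> k) s a \<le> c" and "K \<le> k"
  shows "dual_gap k s a b \<le> dual_gap K s a b + \<eta> * c * (real k - real K)"
  using dual_gap_ge[of K "- c" s a b k] assms by (force simp: dual_gap_swap[of _ s b a])

lemma phi_iterate_ge: "\<phi> 1 \<le> \<phi> (pmf (\<pi> k s) a)"
  by (simp add: phi_le_iff iterate_pos pmf_le_1)

lemma V_iterates_mono: "incseq (\<lambda>k. V (\<pi> k))"
proof (rule incseq_SucI, rule V_mono_of_improvement)
  fix k s
  show "V (\<pi> k) s \<le> (\<Sum>a\<in>UNIV. pmf (\<pi> (Suc k) s) a * Q (\<pi> k) s a)"
    using mirror_step_improves[OF iterate_in_I eta_pos pmd_step, of k s] by (simp add: V_eq_average_Q)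
qed

definition V_lim where "V_lim s = (SUP k. V (\<pi> k) s)"

lemma V_iterates_tendsto: "(\<lambda>k. V (\<pi> k) s) \<longlonglongrightarrow> V_lim s"
  unfolding V_lim_def
  by (rule LIMSEQ_incseq_SUP)
     (use V_iterates_mono V_bounds(2) in \<open>auto simp: mono_def le_fun_def intro!: bdd_aboveI2\<close>)

lemma Q_iterates_tendsto: "(\<lambda>k. Q (\<pi> k) s a) \<longlonglongrightarrow> backup V_lim s a"
  unfolding Q_eq_backup_V by (rule tendsto_backup[of "\<lambda>k. V (\<pi> k)" V_lim, OF V_iterates_tendsto])

text \<open>
  Eventually the dual gap grows by at least \<open>\<eta> c\<close> per step.  The dual variable of \<open>b\<close> is bounded
  below by \<open>\<phi>(1)\<close>, so it is the dual variable of \<open>a\<close> that tends to infinity.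
\<close>

lemma mass_vanishes:
  assumes less: "backup V_lim s a < backup V_lim s b"
  shows "(\<lambda>k. pmf (\<pi> k s) a) \<longlonglongrightarrow> 0"
proof -
  define c where "c = (backup V_lim s b - backup V_lim s a) / 2"
  have c: "0 < c" "c < backup V_lim s b - backup V_lim s a" using less by (simp_all add: c_def)
  have "(\<lambda>k. Q (\<pi> k) s b - Q (\<pi> k) s a) \<longlonglongrightarrow> backup V_lim s b - backup V_lim s a"
    by (intro tendsto_diff Q_iterates_tendsto)
  then have "eventually (\<lambda>k. c < Q (\<pi> k) s b - Q (\<pi> k) s a) sequentially"
    using c(2) by (rule order_tendstoD)
  then obtain K where K: "\<And>k. K \<le> k \<Longrightarrow> c \<le> Q (\<pi> k) s b - Q (\<pi> k) s a"
    by (auto simp: eventually_sequentially intro: less_imp_le)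
  define B where "B = \<phi> 1 + dual_gap K s a b - \<eta> * c * real K"
  have ge: "B + \<eta> * c * real k \<le> \<phi> (pmf (\<pi> k s) a)" if "K \<le> k" for k
    using dual_gap_ge[of K c s b a k, OF K that] phi_iterate_ge[of k s b]
    by (simp add: B_def dual_gap_def algebra_simps)
  have "0 < \<eta> * c" using eta_pos c by simp
  then have "filterlim (\<lambda>k. B + \<eta> * c * real k) at_top sequentially"
    by real_asymp
  then have top: "filterlim (\<lambda>k. \<phi> (pmf (\<pi> k s) a)) at_top sequentially"
    by (rule filterlim_at_top_mono) (use ge in \<open>auto simp: eventually_sequentially\<close>)
  show ?thesis
  proof (rule order_tendstoI)
    fix e :: real assume "0 < e"
    then have e: "0 < min e 1" "min e 1 \<le> 1" by auto
    have "eventually (\<lambda>k. \<phi> (min e 1) < \<phi> (pmf (\<pi> k s) a)) sequentially"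
      using top by (simp add: filterlim_at_top_dense)
    then show "eventually (\<lambda>k. pmf (\<pi> k s) a < e) sequentially"
      by eventually_elim (use e in \<open>simp add: phi_less_iff iterate_pos pmf_le_1\<close>)
  qed (simp add: less_le_trans[OF _ pmf_nonneg])
qed

text \<open>
  \<open>V\<^sup>k(s) - M\<close> is the average of \<open>Q\<^sup>k(s,a) - M\<close> under \<open>\<pi>\<^sub>k\<close>: for a limit-greedy action the second
  factor vanishes in the limit, for any other action the mass does.
\<close>

lemma V_lim_fixpoint: "V_lim s = (MAX a. backup V_lim s a)"
proof -
  define M where "M = (MAX a. backup V_lim s a)"
  have le: "backup V_lim s a \<le> M" for a by (simp add: M_def)
  have "M \<in> range (backup V_lim s)" unfolding M_def by (rule Max_in) auto
  then obtain b where b: "backup V_lim s b = M" by auto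
  have term_lim: "(\<lambda>k. pmf (\<pi> k s) a * (Q (\<pi> k) s a - M)) \<longlonglongrightarrow> 0" for a
  proof -
    have diff: "(\<lambda>k. Q (\<pi> k) s a - M) \<longlonglongrightarrow> backup V_lim s a - M"
      by (intro tendsto_intros Q_iterates_tendsto)
    show ?thesis
    proof (cases "backup V_lim s a = M")
      case True
      with diff have "(\<lambda>k. Q (\<pi> k) s a - M) \<longlonglongrightarrow> 0" by simp
      then show ?thesis
        by (rule Lim_null_comparison[OF _ tendsto_rabs_zero, rotated])
           (simp add: abs_mult mult_left_le_one_le pmf_le_1)
    next
      case False
      then have "(\<lambda>k. pmf (\<pi> k s) a) \<longlonglongrightarrow> 0"
        using le[of a] b by (intro mass_vanishes[of s a b]) auto
      from tendsto_mult[OF this diff] show ?thesis by simp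
    qed
  qed
  have "V (\<pi> k) s - M = (\<Sum>a\<in>UNIV. pmf (\<pi> k s) a * (Q (\<pi> k) s a - M))" for k
    by (simp add: V_eq_average_Q right_diff_distrib sum_subtractf sum_distrib_right[symmetric] sum_pmf_eq_1)
  then have "(\<lambda>k. V (\<pi> k) s - M) \<longlonglongrightarrow> 0"
    using tendsto_sum[of UNIV "\<lambda>a k. pmf (\<pi> k s) a * (Q (\<pi> k) s a - M)" "\<lambda>_. 0" sequentially] term_lim
    by simp
  then have "(\<lambda>k. V (\<pi> k) s) \<longlonglongrightarrow> M" by (simp add: LIM_zero_iff)
  with V_iterates_tendsto show ?thesis unfolding M_def by (rule LIMSEQ_unique)
qed

lemma V_opt_eq: "V\<^sub>o s = V_lim s" and Q_opt_eq: "Q\<^sub>o s a = backup V_lim s a"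
  by (rule optimal_values_of_limit[OF V_iterates_tendsto V_lim_fixpoint])+

lemma Q_opt_eq_backup: "Q\<^sub>o s a = backup V\<^sub>o s a"
  by (simp add: Q_opt_eq V_opt_eq[abs_def])

lemma Q_opt_le_V_opt: "Q\<^sub>o s a \<le> V\<^sub>o s"
  by (simp only: V_opt_eq Q_opt_eq) (subst V_lim_fixpoint, simp)

lemma opt_action_exists: "\<exists>b. Q\<^sub>o s b = V\<^sub>o s"
proof -
  have "(MAX a. backup V_lim s a) \<in> range (backup V_lim s)" by (rule Max_in) auto
  then show ?thesis by (auto simp: V_opt_eq Q_opt_eq simp flip: V_lim_fixpoint)
qed

lemma Q_le_Q_opt: "Q (\<pi> k) s a \<le> Q\<^sub>o s a"
  unfolding Q_eq_backup_V Q_opt_eq_backup by (intro backup_mono le_funI V_le_V_opt)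

lemma Q_opt_nonneg: "0 \<le> Q\<^sub>o s a"
  unfolding Q_opt_eq_backup backup_def
  using discount_bounds by (intro add_nonneg_nonneg mult_nonneg_nonneg sum_nonneg reward_bounds V_opt_bounds) auto

section \<open>Rates of convergence\<close>

lemma Q_iterates_close:
  assumes "0 < \<sigma>"
  obtains K where "\<And>k s a. K \<le> k \<Longrightarrow> Q\<^sub>o s a - \<sigma> \<le> Q (\<pi> k) s a"
proof -
  have "eventually (\<lambda>k. Q\<^sub>o s a - \<sigma> < Q (\<pi> k) s a) sequentially" for s a
    by (rule order_tendstoD(1)[OF Q_iterates_tendsto]) (use assms in \<open>simp add: Q_opt_eq\<close>)
  then have "eventually (\<lambda>k. \<forall>s a. Q\<^sub>o s a - \<sigma> < Q (\<pi> k) s a) sequentially"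
    by (simp add: eventually_all_finite)
  then have "\<exists>K. \<forall>k\<ge>K. \<forall>s a. Q\<^sub>o s a - \<sigma> < Q (\<pi> k) s a"
    by (simp add: eventually_sequentially)
  then show ?thesis using that by (meson less_imp_le)
qed

lemma dual_gap_bound:
  obtains B where "\<And>s a b. \<bar>dual_gap K s a b\<bar> \<le> B"
proof
  fix s a b
  show "\<bar>dual_gap K s a b\<bar> \<le> (MAX (s, a, b). \<bar>dual_gap K s a b\<bar>)"
    by (rule Max_ge) (auto intro: image_eqI[where x="(s, a, b)"])
qed

lemma suboptimality_eq: "V\<^sub>o s - V (\<pi> k) s = (\<Sum>a\<in>UNIV. pmf (\<pi> k s) a * (V\<^sub>o s - Q (\<pi> k) s a))"
  by (simp add: V_eq_average_Q right_diff_distrib sum_subtractf sum_distrib_right[symmetric] sum_pmf_eq_1)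

text \<open>
  The loss splits into an immediate part \<open>V\<^sup>* - Q\<^sup>*\<close>, which only suboptimal actions incur and which is
  at most \<open>1 / (1 - \<gamma>)\<close>, and a discounted future loss; the contraction argument supplies the second
  factor \<open>1 / (1 - \<gamma>)\<close>.
\<close>

lemma suboptimality_le:
  assumes \<delta>: "\<And>s a. a \<notin> opt_actions P r \<gamma> s \<Longrightarrow> pmf (\<pi> k s) a \<le> \<delta>" and "0 \<le> \<delta>"
  shows "sup_norm (\<lambda>s. V\<^sub>o s - V (\<pi> k) s) \<le> real CARD('a) / (1 - \<gamma>)\<^sup>2 * \<delta>"
proof (rule sup_norm_le)
  fix s
  have loss: "pmf (\<pi> k s) a * (V\<^sub>o s - Q\<^sub>o s a) \<le> \<delta> / (1 - \<gamma>)" for s a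
  proof (cases "a \<in> opt_actions P r \<gamma> s")
    case True
    then show ?thesis using \<open>0 \<le> \<delta>\<close> discount_bounds by (simp add: opt_actions_def)
  next
    case False
    have "pmf (\<pi> k s) a * (V\<^sub>o s - Q\<^sub>o s a) \<le> \<delta> * (1 / (1 - \<gamma>))"
      using \<delta>[OF False] \<open>0 \<le> \<delta>\<close> Q_opt_le_V_opt[of s a] Q_opt_nonneg[of s a] V_opt_bounds[of s]
      by (intro mult_mono) auto
    then show ?thesis by simp
  qed
  have "V\<^sub>o s - V (\<pi> k) s \<le> (real CARD('a) * (\<delta> / (1 - \<gamma>))) / (1 - \<gamma>)"
  proof (rule bellman_contraction)
    fix c s assume c: "\<And>s. V\<^sub>o s - V (\<pi> k) s \<le> c"
    have Q: "Q\<^sub>o s a \<le> Q (\<pi> k) s a + \<gamma> * c" for a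
      unfolding Q_eq_backup_V Q_opt_eq_backup by (intro backup_le_add c)
    have "V\<^sub>o s - V (\<pi> k) s
        \<le> (\<Sum>a\<in>UNIV. pmf (\<pi> k s) a * ((V\<^sub>o s - Q\<^sub>o s a) + \<gamma> * c))"
      unfolding suboptimality_eq by (rule average_mono) (use Q in \<open>simp add: algebra_simps\<close>)
    also have "\<dots> = (\<Sum>a\<in>UNIV. pmf (\<pi> k s) a * (V\<^sub>o s - Q\<^sub>o s a)) + \<gamma> * c"
      by (simp add: distrib_left sum.distrib sum_distrib_right[symmetric] sum_pmf_eq_1)
    also have "\<dots> \<le> (\<Sum>a\<in>(UNIV::'a set). \<delta> / (1 - \<gamma>)) + \<gamma> * c"
      by (intro add_right_mono sum_mono loss)
    finally show "V\<^sub>o s - V (\<pi> k) s \<le> real CARD('a) * (\<delta> / (1 - \<gamma>)) + \<gamma> * c" by simp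
  qed
  then show "\<bar>V\<^sub>o s - V (\<pi> k) s\<bar> \<le> real CARD('a) / (1 - \<gamma>)\<^sup>2 * \<delta>"
    using V_le_V_opt[of "\<pi> k" s] by (simp add: power2_eq_square)
qed

lemma suboptimality_ge: "pmf (\<pi> k s) a * (V\<^sub>o s - Q\<^sub>o s a) \<le> sup_norm (\<lambda>s. V\<^sub>o s - V (\<pi> k) s)"
proof -
  have nonneg: "0 \<le> pmf (\<pi> k s) a * (V\<^sub>o s - Q (\<pi> k) s a)" for a
    using Q_le_Q_opt[of k s a] Q_opt_le_V_opt[of s a] by (intro mult_nonneg_nonneg) auto
  have "pmf (\<pi> k s) a * (V\<^sub>o s - Q\<^sub>o s a) \<le> pmf (\<pi> k s) a * (V\<^sub>o s - Q (\<pi> k) s a)"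
    using Q_le_Q_opt[of k s a] by (intro mult_left_mono) auto
  also have "\<dots> \<le> V\<^sub>o s - V (\<pi> k) s"
    unfolding suboptimality_eq by (rule member_le_sum) (use nonneg in auto)
  also have "\<dots> \<le> \<bar>V\<^sub>o s - V (\<pi> k) s\<bar>" by simp
  also have "\<dots> \<le> sup_norm (\<lambda>s. V\<^sub>o s - V (\<pi> k) s)"
    by (rule abs_le_sup_norm)
  finally show ?thesis .
qed

abbreviation "\<Delta> \<equiv> gap P r \<gamma>"

text \<open>
  The constant \<open>C\<close> absorbs the dual gaps at the time \<open>K\<close> from which \<open>Q\<^sup>k\<close> is close to \<open>Q\<^sup>*\<close>.  The start
  \<open>T\<close> must moreover be so late that the argument of \<open>\<phi>\<^sup>-\<^sup>1\<close> has entered its domain.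
\<close>

lemma upper_rate:
  assumes \<sigma>: "0 < \<sigma>" "\<sigma> < \<Delta> / 2"
  shows "\<exists>(T::nat) C. \<forall>k\<ge>T. \<phi> 1 \<le> real k * \<eta> * (\<Delta> - 2 * \<sigma>) - C \<and>
    sup_norm (\<lambda>s. V\<^sub>o s - V (\<pi> k) s)
      \<le> real CARD('a) / (1 - \<gamma>)\<^sup>2 * phi_inv \<psi> (real k * \<eta> * (\<Delta> - 2 * \<sigma>) - C)"
proof -
  obtain K where K: "\<And>k s a. K \<le> k \<Longrightarrow> Q\<^sub>o s a - \<sigma> \<le> Q (\<pi> k) s a"
    using Q_iterates_close[OF \<sigma>(1)] by blast
  obtain B where B: "\<And>s a b. \<bar>dual_gap K s a b\<bar> \<le> B" using dual_gap_bound by blast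
  define m where "m = \<eta> * (\<Delta> - 2 * \<sigma>)"
  define C where "C = B - \<phi> 1 + m * real K"
  have m: "0 < m" using eta_pos \<sigma> by (simp add: m_def)
  obtain T0 :: nat where T0: "(\<phi> 1 + C) / m < real T0" using reals_Archimedean2 by blast
  show ?thesis
  proof (intro exI[of _ "max K T0"] exI[of _ C] allI impI)
    fix k assume k: "max K T0 \<le> k"
    define y where "y = real k * \<eta> * (\<Delta> - 2 * \<sigma>) - C"
    have y: "y = m * real k - C" by (simp add: y_def m_def mult_ac)
    have "(\<phi> 1 + C) / m < real k" using T0 k by simp
    with m have y1: "\<phi> 1 \<le> y" by (simp add: y field_simps)
    have "pmf (\<pi> k s) a \<le> phi_inv \<psi> y" if a: "a \<notin> opt_actions P r \<gamma> s" for s a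
    proof -
      obtain b where b: "Q\<^sub>o s b = V\<^sub>o s" using opt_action_exists by blast
      have "\<Delta> - 2 * \<sigma> \<le> Q (\<pi> k) s b - Q (\<pi> k) s a" if "K \<le> k" for k
        using K[OF that, of s b] b Q_le_Q_opt[of k s a] Q_opt_le_of_suboptimal[OF a] \<sigma> by linarith
      from dual_gap_ge[of K "\<Delta> - 2 * \<sigma>" s b a k, OF this]
      have "dual_gap K s a b + m * (real k - real K) \<le> dual_gap k s a b"
        using k by (simp add: m_def)
      with B[of s a b] phi_iterate_ge[of k s b] have "y \<le> \<phi> (pmf (\<pi> k s) a)"
        by (simp add: y C_def dual_gap_def algebra_simps)
      then show ?thesis using y1 by (simp add: le_phi_inv_iff iterate_pos pmf_le_1)
    qed
    then have "sup_norm (\<lambda>s. V\<^sub>o s - V (\<pi> k) s) \<le> real CARD('a) / (1 - \<gamma>)\<^sup>2 * phi_inv \<psi> y"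
      by (rule suboptimality_le) (auto intro: less_imp_le phi_inv_works(1)[OF y1])
    with y1 show "\<phi> 1 \<le> real k * \<eta> * (\<Delta> - 2 * \<sigma>) - C \<and>
        sup_norm (\<lambda>s. V\<^sub>o s - V (\<pi> k) s)
          \<le> real CARD('a) / (1 - \<gamma>)\<^sup>2 * phi_inv \<psi> (real k * \<eta> * (\<Delta> - 2 * \<sigma>) - C)"
      by (simp add: y_def)
  qed
qed

text \<open>
  The reference action \<open>b\<close> may change with \<open>k\<close>, which is harmless because the growth bound and the
  bound on the initial dual gap are uniform over all actions: \<open>Q\<^sup>k(b) \<le> V\<^sup>*\<close> holds for each of them.
\<close>

lemma lower_rate:
  assumes \<sigma>: "0 < \<sigma>" "\<sigma> < \<Delta> / 2" and nontrivial: "nontrivial_states P r \<gamma> \<noteq> {}"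
  shows "\<exists>(T::nat) C. \<forall>k\<ge>T. \<phi> 1 \<le> real k * \<eta> * (\<Delta> + 2 * \<sigma>) - C \<and>
    \<Delta> * phi_inv \<psi> (real k * \<eta> * (\<Delta> + 2 * \<sigma>) - C) \<le> sup_norm (\<lambda>s. V\<^sub>o s - V (\<pi> k) s)"
proof -
  obtain K where K: "\<And>k s a. K \<le> k \<Longrightarrow> Q\<^sub>o s a - \<sigma> \<le> Q (\<pi> k) s a"
    using Q_iterates_close[OF \<sigma>(1)] by blast
  obtain B where B: "\<And>s a b. \<bar>dual_gap K s a b\<bar> \<le> B" using dual_gap_bound by blast
  obtain s a where sa: "Q\<^sub>o s a = V\<^sub>o s - \<Delta>" using gap_attained[OF nontrivial] by blast
  define m where "m = \<eta> * (\<Delta> + 2 * \<sigma>)"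
  define C where "C = m * real K - B - \<phi> (1 / real CARD('a))"
  show ?thesis
  proof (intro exI[of _ K] exI[of _ C] allI impI)
    fix k assume k: "K \<le> k"
    define y where "y = real k * \<eta> * (\<Delta> + 2 * \<sigma>) - C"
    have y: "y = m * real k - C" by (simp add: y_def m_def mult_ac)
    obtain b where b: "1 / real CARD('a) \<le> pmf (\<pi> k s) b"
      using exists_pmf_ge_inverse_card by blast
    then have "\<phi> (pmf (\<pi> k s) b) \<le> \<phi> (1 / real CARD('a))"
      by (subst phi_le_iff) (auto simp: iterate_pos pmf_le_1)
    moreover have "Q (\<pi> k) s b - Q (\<pi> k) s a \<le> \<Delta> + 2 * \<sigma>" if "K \<le> k" for k
      using K[OF that, of s a] sa Q_le_Q_opt[of k s b] Q_opt_le_V_opt[of s b] \<sigma> by linarith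
    from dual_gap_le[of K s b a "\<Delta> + 2 * \<sigma>" k, OF this k]
    have "dual_gap k s a b \<le> dual_gap K s a b + m * (real k - real K)" by (simp add: m_def)
    ultimately have phi_le: "\<phi> (pmf (\<pi> k s) a) \<le> y"
      using B[of s a b] by (simp add: y C_def dual_gap_def algebra_simps)
    with phi_iterate_ge[of k s a] have y1: "\<phi> 1 \<le> y" by simp
    with phi_le have "phi_inv \<psi> y \<le> pmf (\<pi> k s) a"
      by (simp add: phi_inv_le_iff iterate_pos pmf_le_1)
    then have "\<Delta> * phi_inv \<psi> y \<le> pmf (\<pi> k s) a * (V\<^sub>o s - Q\<^sub>o s a)"
      using \<sigma> by (simp add: sa mult.commute)
    also have "\<dots> \<le> sup_norm (\<lambda>s. V\<^sub>o s - V (\<pi> k) s)" by (rule suboptimality_ge)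
    finally show "\<phi> 1 \<le> real k * \<eta> * (\<Delta> + 2 * \<sigma>) - C \<and>
        \<Delta> * phi_inv \<psi> (real k * \<eta> * (\<Delta> + 2 * \<sigma>) - C) \<le> sup_norm (\<lambda>s. V\<^sub>o s - V (\<pi> k) s)"
      using y1 by (simp add: y_def)
  qed
qed

end

section \<open>Two-sided bound for the suboptimality of policy mirror descent\<close>

theorem theorem3p7:
  fixes P :: "'s::finite \<Rightarrow> 'a::finite \<Rightarrow> 's pmf"
    and r :: "'s \<Rightarrow> 'a \<Rightarrow> real"
    and \<gamma> \<eta> :: real
    and \<psi> :: "real \<Rightarrow> ereal"
    and d1 :: ereal
    and \<pi> :: "nat \<Rightarrow> ('s, 'a) policy"
  assumes reward: "\<And>s a. r s a \<in> {0..1}"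
    and discount: "\<gamma> \<in> {0..<1}"
    and nontrivial: "nontrivial_states P r \<gamma> \<noteq> {}"
    and mirror: "mirror_map \<psi>"
    and step: "\<eta> > 0"
    and pmd: "pmd_sequence P r \<gamma> \<psi> \<eta> \<pi>"
    and deriv_0: "((\<lambda>x. ereal (ederiv \<psi> x)) \<longlongrightarrow> -\<infinity>) (at_right 0)"
    and deriv_1: "((\<lambda>x. ereal (ederiv \<psi> x)) \<longlongrightarrow> d1) (at_left 1)" "d1 < \<infinity>"
  shows "continuous_on {0<..1} (phi \<psi>) \<and>
    strict_antimono_on {0<..1} (phi \<psi>) \<and>
    phi \<psi> ` {0<..1} = {y. - d1 \<le> ereal y} \<and>
    (\<forall>\<sigma>\<in>{0<..<gap P r \<gamma> / 2}. \<exists>(T1::nat) (T2::nat) (C1::real) (C2::real).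
      (\<forall>k\<ge>T1.
         real k * \<eta> * (gap P r \<gamma> - 2 * \<sigma>) - C1 \<in> phi \<psi> ` {0<..1} \<and>
         sup_norm (\<lambda>s. V_opt P r \<gamma> s - V_fun P r \<gamma> (\<pi> k) s)
           \<le> real CARD('a) / (1 - \<gamma>)\<^sup>2
               * phi_inv \<psi> (real k * \<eta> * (gap P r \<gamma> - 2 * \<sigma>) - C1)) \<and>
      (\<forall>k\<ge>T2.
         real k * \<eta> * (gap P r \<gamma> + 2 * \<sigma>) - C2 \<in> phi \<psi> ` {0<..1} \<and>
         sup_norm (\<lambda>s. V_opt P r \<gamma> s - V_fun P r \<gamma> (\<pi> k) s)
           \<ge> gap P r \<gamma>
               * phi_inv \<psi> (real k * \<eta> * (gap P r \<gamma> + 2 * \<sigma>) - C2)))"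
proof -
  interpret pmd_run P r \<gamma> \<psi> d1 \<eta> \<pi>
    by unfold_locales (fact assms)+
  have image: "phi \<psi> ` {0<..1} = {y. - d1 \<le> ereal y}"
    unfolding image_phi by (auto simp: d1_eq phi_def)
  show ?thesis
  proof (intro conjI ballI)
    fix \<sigma> assume "\<sigma> \<in> {0<..<gap P r \<gamma> / 2}"
    then have \<sigma>: "0 < \<sigma>" "\<sigma> < gap P r \<gamma> / 2" by auto
    from upper_rate[OF \<sigma>] lower_rate[OF \<sigma> nontrivial]
    show "\<exists>(T1::nat) (T2::nat) (C1::real) (C2::real).
      (\<forall>k\<ge>T1.
         real k * \<eta> * (gap P r \<gamma> - 2 * \<sigma>) - C1 \<in> phi \<psi> ` {0<..1} \<and>
         sup_norm (\<lambda>s. V_opt P r \<gamma> s - V_fun P r \<gamma> (\<pi> k) s)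
           \<le> real CARD('a) / (1 - \<gamma>)\<^sup>2
               * phi_inv \<psi> (real k * \<eta> * (gap P r \<gamma> - 2 * \<sigma>) - C1)) \<and>
      (\<forall>k\<ge>T2.
         real k * \<eta> * (gap P r \<gamma> + 2 * \<sigma>) - C2 \<in> phi \<psi> ` {0<..1} \<and>
         sup_norm (\<lambda>s. V_opt P r \<gamma> s - V_fun P r \<gamma> (\<pi> k) s)
           \<ge> gap P r \<gamma>
               * phi_inv \<psi> (real k * \<eta> * (gap P r \<gamma> + 2 * \<sigma>) - C2))"
      unfolding image_phi atLeast_iff by blast
  qed (fact continuous_on_phi strict_antimono_phi image)+
qed

end
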